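(* Suppose that $\xi_1$ has distribution $\mu$ on $\mathbb S^2$, where $\mu$ is absolutely continuous with respect to the normalized area measure $\nu_1$ and $d\mu=f\,d\nu_1$ with $f$ bounded, $\|f\|_\infty\le M$. Let $\xi_1,\dots,\xi_N$ be mutually independent copies of $\xi_1$ and let $L_N^\xi=N^{-1}\sum_{j=1}^N\delta_{\xi_j}$ be the empirical measure from $N$ samples. Then $$\int_{(\mathbb S^2)^N}W_1(L_N^\xi,\mu)\,d\mu^{\otimes N}=O(N^{-1/4})\qquad(N\to\infty).$$
   Context: $W_1$ is the Wasserstein distance of order $1$ on probability measures on $\mathbb S^2$ for the cost given by the geodesic distance on the unit sphere $\mathbb S^2$; $\nu_1$ is the rotation-invariant area measure normalized to have total mass one. *)

theory Defs
  imports "HOL-Probability.Probability"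
begin

section \<open>The unit sphere and its area measure\<close>

definition S2 :: "(real^3) set" where
  "S2 = sphere 0 1"

definition borel_S2 :: "(real^3) measure" where
  "borel_S2 = restrict_space borel S2"

text \<open>
  The surface area of \<open>A \<subseteq> S2\<close> is three times the volume of the cone
  \<open>{x. 0 < norm x \<le> 1, x / norm x \<in> A}\<close> over \<open>A\<close>
  (polar coordinates: \<open>dx = r^2 dr d\<sigma>\<close> and the integral of \<open>r^2\<close> over \<open>[0, 1]\<close> is \<open>1/3\<close>).
  Total mass and invariance under the orthogonal group are checked in
  \<open>emeasure_area_S2\<close> and \<open>area_S2_invariant\<close>, and for the normalized measure in
  \<open>prob_space_nu1\<close> and \<open>nu1_invariant\<close>.
\<close>

definition area_S2 :: "(real^3) measure" where
  "area_S2 = scale_measure 3 (distr (restrict_space lborel (cball 0 1 - {0})) borel_S2 sgn)"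

definition nu1 :: "(real^3) measure" where
  "nu1 = scale_measure (1 / emeasure area_S2 S2) area_S2"

lemma space_borel_S2 [simp]: "space borel_S2 = S2"
  by (simp add: borel_S2_def space_restrict_space)

lemma sets_area_S2 [simp, measurable_cong]: "sets area_S2 = sets borel_S2"
  by (simp add: area_S2_def)

lemma sets_nu1 [simp, measurable_cong]: "sets nu1 = sets borel_S2"
  by (simp add: nu1_def)

lemma space_nu1 [simp]: "space nu1 = S2"
  using sets_eq_imp_space_eq[OF sets_nu1] by simp

lemma sets_borel_S2_iff: "A \<in> sets borel_S2 \<longleftrightarrow> A \<subseteq> S2 \<and> A \<in> sets borel"
  by (auto simp: borel_S2_def S2_def sets_restrict_space_iff)

lemma measurable_sgn_S2:
  "sgn \<in> restrict_space lborel (cball (0::real^3) 1 - {0}) \<rightarrow>\<^sub>M borel_S2"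
  unfolding borel_S2_def
proof (rule measurable_restrict_space2)
  show "sgn \<in> space (restrict_space lborel (cball (0::real^3) 1 - {0})) \<rightarrow> S2"
    by (auto simp: S2_def space_restrict_space norm_sgn)
  have "(sgn :: real^3 \<Rightarrow> real^3) = (\<lambda>x. x /\<^sub>R norm x)"
    by (auto simp: sgn_div_norm)
  then have "(sgn :: real^3 \<Rightarrow> real^3) \<in> borel_measurable lborel"
    by simp
  then show "(sgn :: real^3 \<Rightarrow> real^3) \<in> borel_measurable (restrict_space lborel (cball 0 1 - {0}))"
    by (rule measurable_restrict_space1)
qed

lemma cone_S2_sets:
  assumes "A \<in> sets borel_S2"
  shows "{x. 0 < norm x \<and> norm x \<le> 1 \<and> sgn x \<in> A} \<in> sets lborel"
proof -
  have "sgn -` A \<inter> (cball (0::real^3) 1 - {0}) \<in> sets (restrict_space lborel (cball 0 1 - {0}))"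
    using measurable_sets[OF measurable_sgn_S2 assms] by (simp add: space_restrict_space)
  moreover have "sgn -` A \<inter> (cball (0::real^3) 1 - {0})
      = {x. 0 < norm x \<and> norm x \<le> 1 \<and> sgn x \<in> A}"
    by auto
  ultimately show ?thesis
    by (simp add: sets_restrict_space_iff)
qed

lemma emeasure_area_S2_cone:
  assumes "A \<in> sets borel_S2"
  shows "emeasure area_S2 A = 3 * emeasure lborel {x. 0 < norm x \<and> norm x \<le> 1 \<and> sgn x \<in> A}"
proof -
  have "sgn -` A \<inter> (cball (0::real^3) 1 - {0})
      = {x. 0 < norm x \<and> norm x \<le> 1 \<and> sgn x \<in> A}"
    by auto
  moreover have "emeasure (restrict_space lborel (cball 0 1 - {0}))
      {x::real^3. 0 < norm x \<and> norm x \<le> 1 \<and> sgn x \<in> A}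
      = emeasure lborel {x. 0 < norm x \<and> norm x \<le> 1 \<and> sgn x \<in> A}"
    by (rule emeasure_restrict_space) auto
  ultimately show ?thesis
    using assms
    by (simp add: area_S2_def emeasure_distr[OF measurable_sgn_S2] space_restrict_space)
qed

lemma emeasure_area_S2: "emeasure area_S2 S2 = ennreal (4 * pi)"
proof -
  have "S2 \<in> sets borel_S2"
    by (metis sets.top space_borel_S2)
  moreover have "{x. 0 < norm x \<and> norm x \<le> 1 \<and> sgn x \<in> S2} = cball (0::real^3) 1 - {0}"
    by (auto simp: S2_def norm_sgn)
  moreover have "emeasure lborel (cball (0::real^3) 1 - {0}) = ennreal (4 / 3 * pi)"
    by (subst emeasure_Diff) (simp_all add: emeasure_cball unit_ball_vol_numeral(2) fact_numeral)
  ultimately show ?thesis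
    by (simp add: emeasure_area_S2_cone flip: ennreal_numeral ennreal_mult')
qed

lemma area_S2_invariant:
  assumes T: "orthogonal_transformation T" and A: "A \<in> sets borel_S2"
  shows "T ` A \<in> sets borel_S2" "emeasure area_S2 (T ` A) = emeasure area_S2 A"
proof -
  let ?C = "\<lambda>A. {x :: real^3. 0 < norm x \<and> norm x \<le> 1 \<and> sgn x \<in> A}"
  have bij: "bij T" and lin: "linear T" and nrm: "\<And>x. norm (T x) = norm x"
    using T by (auto simp: orthogonal_transformation_bij orthogonal_transformation_linear
        orthogonal_transformation_norm)
  have inv: "orthogonal_transformation (inv T)"
    using T by (rule orthogonal_transformation_inv)
  have "T ` A = inv T -` A"
    using bij by (simp add: bij_vimage_eq_inv_image bij_imp_bij_inv inv_inv_eq)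
  moreover have "inv T \<in> borel_measurable borel"
    by (intro borel_measurable_continuous_onI linear_continuous_on
        linear_conv_bounded_linear[THEN iffD1] orthogonal_transformation_linear inv)
  ultimately have "T ` A \<in> sets borel"
    using A measurable_sets[of "inv T" borel borel A] by (auto simp: sets_borel_S2_iff)
  moreover have "T ` A \<subseteq> S2"
    using A nrm by (auto simp: sets_borel_S2_iff S2_def)
  ultimately show TA: "T ` A \<in> sets borel_S2"
    by (simp add: sets_borel_S2_iff)
  have sgnT: "sgn (T x) = T (sgn x)" for x
    by (simp add: sgn_div_norm nrm linear_cmul[OF lin])
  have C: "?C (T ` A) = T ` ?C A"
  proof (intro equalityI subsetI)
    fix y assume y: "y \<in> ?C (T ` A)"
    obtain x where "y = T x"
      using bij by (metis bij_pointE)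
    with y bij have "x \<in> ?C A"
      by (simp add: nrm sgnT bij_is_inj inj_image_mem_iff flip: zero_less_norm_iff)
    with \<open>y = T x\<close> show "y \<in> T ` ?C A"
      by blast
  next
    fix y assume "y \<in> T ` ?C A"
    then obtain x where "y = T x" "x \<in> ?C A"
      by blast
    then show "y \<in> ?C (T ` A)"
      by (simp add: nrm sgnT flip: zero_less_norm_iff)
  qed
  have lm: "?C B \<in> lmeasurable" if "B \<in> sets borel_S2" for B
  proof (rule bounded_set_imp_lmeasurable)
    show "bounded (?C B)"
      by (rule bounded_subset[of "cball 0 1"]) auto
    show "?C B \<in> sets lebesgue"
      using cone_S2_sets[OF that] by (simp add: sets_completionI_sets)
  qed
  have "emeasure lebesgue (?C (T ` A)) = emeasure lebesgue (?C A)"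
    using measure_orthogonal_image[OF T lm[OF A]] lm[OF A] lm[OF TA]
    unfolding C by (simp add: emeasure_eq_measure2)
  then have "emeasure lborel (?C (T ` A)) = emeasure lborel (?C A)"
    using cone_S2_sets[OF A] cone_S2_sets[OF TA] by simp
  then show "emeasure area_S2 (T ` A) = emeasure area_S2 A"
    using A TA by (simp add: emeasure_area_S2_cone)
qed

lemma prob_space_nu1: "prob_space nu1"
proof (rule prob_spaceI)
  show "emeasure nu1 (space nu1) = 1"
    by (simp add: nu1_def[THEN arg_cong[where f = emeasure]] emeasure_area_S2
        ennreal_times_divide[symmetric] ennreal_divide_times)
qed

lemma nu1_invariant:
  assumes "orthogonal_transformation T" "A \<in> sets borel_S2"
  shows "emeasure nu1 (T ` A) = emeasure nu1 A"
  using area_S2_invariant[OF assms] by (simp add: nu1_def)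


section \<open>The Wasserstein distance of order one for the geodesic distance\<close>

text \<open>On \<open>S2\<close> this is the length of the shorter great circle arc from \<open>x\<close> to \<open>y\<close>.\<close>

definition geodesic_dist :: "real^3 \<Rightarrow> real^3 \<Rightarrow> real" where
  "geodesic_dist x y = arccos (x \<bullet> y)"

definition couplings :: "'a measure \<Rightarrow> 'b measure \<Rightarrow> ('a \<times> 'b) measure set" where
  "couplings \<alpha> \<beta> = {\<pi>. sets \<pi> = sets (\<alpha> \<Otimes>\<^sub>M \<beta>) \<and> distr \<pi> \<alpha> fst = \<alpha> \<and> distr \<pi> \<beta> snd = \<beta>}"

text \<open>
  For probability measures on \<open>S2\<close> the infimum is over a nonempty set of reals in \<open>[0, pi]\<close>,
  see \<open>pair_measure_in_couplings\<close> and \<open>integrable_geodesic_dist\<close>.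
\<close>

definition W1 :: "(real^3) measure \<Rightarrow> (real^3) measure \<Rightarrow> real" where
  "W1 \<alpha> \<beta> = (INF \<pi> \<in> couplings \<alpha> \<beta>. \<integral>z. geodesic_dist (fst z) (snd z) \<partial>\<pi>)"

lemma pair_measure_in_couplings:
  assumes "prob_space \<alpha>" "prob_space \<beta>"
  shows "\<alpha> \<Otimes>\<^sub>M \<beta> \<in> couplings \<alpha> \<beta>"
proof -
  interpret A: prob_space \<alpha> by fact
  interpret B: prob_space \<beta> by fact
  interpret pair_prob_space \<alpha> \<beta> ..
  have "distr (\<alpha> \<Otimes>\<^sub>M \<beta>) \<beta> snd = \<beta>"
  proof (rule measure_eqI)
    fix X assume X: "X \<in> sets (distr (\<alpha> \<Otimes>\<^sub>M \<beta>) \<beta> snd)"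
    then have "snd -` X \<inter> space (\<alpha> \<Otimes>\<^sub>M \<beta>) = space \<alpha> \<times> X"
      using sets.sets_into_space[of X \<beta>] by (auto simp: space_pair_measure)
    then show "emeasure (distr (\<alpha> \<Otimes>\<^sub>M \<beta>) \<beta> snd) X = emeasure \<beta> X"
      using X by (simp add: emeasure_distr B.emeasure_pair_measure_Times A.emeasure_space_1)
  qed simp
  then show ?thesis
    by (simp add: couplings_def B.distr_pair_fst)
qed

lemma integrable_geodesic_dist:
  assumes "prob_space \<alpha>" "sets \<alpha> = sets borel_S2" "sets \<beta> = sets borel_S2"
    and \<pi>: "\<pi> \<in> couplings \<alpha> \<beta>"
  shows "prob_space \<pi>" "integrable \<pi> (\<lambda>z. geodesic_dist (fst z) (snd z))"
    "(\<integral>z. geodesic_dist (fst z) (snd z) \<partial>\<pi>) \<in> {0..pi}"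
proof -
  have sets: "sets \<pi> = sets (\<alpha> \<Otimes>\<^sub>M \<beta>)" and d: "distr \<pi> \<alpha> fst = \<alpha>"
    using \<pi> by (auto simp: couplings_def)
  have fst: "fst \<in> \<pi> \<rightarrow>\<^sub>M \<alpha>" and snd: "snd \<in> \<pi> \<rightarrow>\<^sub>M \<beta>"
    by (simp_all add: measurable_cong_sets[OF sets refl])
  show "prob_space \<pi>"
    by (rule prob_space_distrD[OF fst]) (simp add: d assms)
  then interpret prob_space \<pi> .
  have id: "(\<lambda>x. x) \<in> borel_S2 \<rightarrow>\<^sub>M borel"
    unfolding borel_S2_def by (rule measurable_restrict_space1) simp
  have "fst \<in> borel_measurable \<pi>" "snd \<in> borel_measurable \<pi>"
    using measurable_compose[OF fst, of "\<lambda>x. x" borel] measurable_compose[OF snd, of "\<lambda>x. x" borel]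
      id by (simp_all add: measurable_cong_sets[OF assms(2) refl] measurable_cong_sets[OF assms(3) refl])
  then have [measurable]: "(\<lambda>z. fst z \<bullet> snd z) \<in> borel_measurable \<pi>"
    by simp
  have spS: "fst z \<in> S2 \<and> snd z \<in> S2" if "z \<in> space \<pi>" for z
    using that measurable_space[OF fst that] measurable_space[OF snd that]
      sets_eq_imp_space_eq[OF assms(2)] sets_eq_imp_space_eq[OF assms(3)] by simp
  have inner: "fst z \<bullet> snd z \<in> {-1..1}" if "z \<in> space \<pi>" for z
    using spS[OF that] Cauchy_Schwarz_ineq2[of "fst z" "snd z"] by (simp add: S2_def abs_le_iff)
  have "arccos \<in> borel_measurable (restrict_space borel {-1..1})"
    by (intro borel_measurable_continuous_on_restrict continuous_on_arccos')
  then have [measurable]: "(\<lambda>z. arccos (fst z \<bullet> snd z)) \<in> borel_measurable \<pi>"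
    by (rule measurable_compose[rotated]) (use inner in \<open>auto intro!: measurable_restrict_space2\<close>)
  have bd: "0 \<le> arccos (fst z \<bullet> snd z) \<and> arccos (fst z \<bullet> snd z) \<le> pi" if "z \<in> space \<pi>" for z
    using inner[OF that] by (simp add: arccos_lbound arccos_ubound)
  show int: "integrable \<pi> (\<lambda>z. geodesic_dist (fst z) (snd z))"
    unfolding geodesic_dist_def
    by (rule integrable_const_bound[where B = pi]) (use bd in auto)
  have "0 \<le> (\<integral>z. geodesic_dist (fst z) (snd z) \<partial>\<pi>)"
    using bd by (intro Bochner_Integration.integral_nonneg) (auto simp: geodesic_dist_def)
  moreover have "(\<integral>z. geodesic_dist (fst z) (snd z) \<partial>\<pi>) \<le> pi"
    using bd by (intro integral_le_const int) (auto simp: geodesic_dist_def)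
  ultimately show "(\<integral>z. geodesic_dist (fst z) (snd z) \<partial>\<pi>) \<in> {0..pi}"
    by simp
qed


section \<open>Empirical measures\<close>

text \<open>
  \<open>1/N\<close> times the sum of the point masses at \<open>\<xi> 1, \<dots>, \<xi> N\<close>, obtained as the image under \<open>\<xi>\<close>
  of the uniform distribution on the indices; see \<open>emeasure_empirical\<close>.
\<close>

definition empirical :: "nat \<Rightarrow> (nat \<Rightarrow> real^3) \<Rightarrow> (real^3) measure" where
  "empirical N \<xi> = distr (uniform_count_measure {1..N}) borel_S2 \<xi>"

lemma emeasure_empirical:
  assumes "N \<ge> 1" "\<xi> \<in> {1..N} \<rightarrow> S2" "A \<in> sets borel_S2"
  shows "emeasure (empirical N \<xi>) A = (\<Sum>j = 1..N. emeasure (return borel_S2 (\<xi> j)) A) / of_nat N"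
proof -
  have "\<xi> \<in> uniform_count_measure {1..N} \<rightarrow>\<^sub>M borel_S2"
    using assms by (auto simp: measurable_def space_uniform_count_measure sets_uniform_count_measure)
  then have "emeasure (empirical N \<xi>) A = emeasure (uniform_count_measure {1..N}) (\<xi> -` A \<inter> {1..N})"
    using assms by (simp add: empirical_def emeasure_distr space_uniform_count_measure)
  also have "\<dots> = ennreal (real (card (\<xi> -` A \<inter> {1..N})) / real N)"
    by (subst emeasure_uniform_count_measure) auto
  also have "\<dots> = of_nat (card (\<xi> -` A \<inter> {1..N})) / of_nat N"
    using assms by (simp add: divide_ennreal[symmetric] ennreal_of_nat_eq_real_of_nat)
  also have "of_nat (card (\<xi> -` A \<inter> {1..N})) = (\<Sum>j = 1..N. indicator A (\<xi> j) :: ennreal)"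
    by (simp add: indicator_def sum.If_cases Int_def vimage_def conj_commute)
  finally show ?thesis
    using assms by (simp add: emeasure_return)
qed

end

theory Submission
  imports Defs
begin

text \<open>
  The bound rests on a partition of the sphere at a single scale. For \<open>\<eta> \<le> 1\<close>, spherical
  coordinates divide the sphere into at most \<open>50 / \<eta>\<^sup>2\<close> cells of geodesic diameter at most
  \<open>10 * \<eta>\<close> (\<open>card_spherical_cells\<close>, \<open>geodesic_dist_spherical_cell\<close>). Any two
  probability measures can be coupled so that the two points lie in different cells with probability
  at most \<open>\<Sum>\<bar>a i - b i\<bar>\<close>, where \<open>a\<close> and \<open>b\<close> are the cell masses (\<open>coupling_of_labels\<close>). As all
  distances are at most \<open>pi\<close>, the Wasserstein distance is at most \<open>10 * \<eta> + pi * (\<Sum>\<bar>a i - b i\<bar>)\<close>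
  (\<open>W1_le_cells\<close>).

  For the empirical measure, \<open>a i - b i\<close> is centred with variance at most \<open>b i / N\<close>, so the expected
  sum over \<open>K\<close> cells is of order \<open>sqrt (K / N)\<close>, that is \<open>1 / (\<eta> * sqrt N)\<close>. The choice
  \<open>\<eta> = N powr (-1/4)\<close> makes both contributions of order \<open>N powr (-1/4)\<close>
  (\<open>expected_W1_empirical_rate\<close>).

  Integrability needs measurability of \<open>\<xi> \<mapsto> W1 (empirical N \<xi>) \<mu>\<close>. This function is continuous on
  tuples of points of the sphere: a coupling of one empirical measure with \<open>\<mu>\<close> can be carried over
  to a nearby sample at a small additional cost (\<open>move_atoms_coupling\<close>).
\<close>

section \<open>Couplings that match finitely many labels\<close>

text \<open>
  The maximal coupling of two probability vectors \<open>a\<close> and \<open>b\<close>, as a density \<open>G\<close> with respect to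
  the product vector: as much mass as possible, \<open>min (a i) (b i)\<close>, stays on the diagonal, and the two
  remainders are coupled independently. The off-diagonal mass is then at most
  \<open>\<Sum>\<bar>a i - b i\<bar>\<close>. The marginal identities are stated at indices of positive mass only;
  the others carry none.
\<close>

lemma discrete_coupling_kernel:
  fixes a b :: "'i \<Rightarrow> real"
  assumes fin: "finite I" and a0: "\<And>i. i \<in> I \<Longrightarrow> 0 \<le> a i" and b0: "\<And>i. i \<in> I \<Longrightarrow> 0 \<le> b i"
    and sum_a: "(\<Sum>i\<in>I. a i) = 1" and sum_b: "(\<Sum>i\<in>I. b i) = 1"
  obtains G :: "'i \<Rightarrow> 'i \<Rightarrow> real"
  where "\<And>i j. i \<in> I \<Longrightarrow> j \<in> I \<Longrightarrow> 0 \<le> G i j"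
    and "\<And>i. i \<in> I \<Longrightarrow> a i > 0 \<Longrightarrow> (\<Sum>j\<in>I. G i j * b j) = 1"
    and "\<And>j. j \<in> I \<Longrightarrow> b j > 0 \<Longrightarrow> (\<Sum>i\<in>I. G i j * a i) = 1"
    and "(\<Sum>i\<in>I. (\<Sum>j\<in>I. of_bool (i \<noteq> j) * G i j * b j) * a i) \<le> (\<Sum>i\<in>I. \<bar>a i - b i\<bar>)"
proof -
  define p where "p i = min (a i) (b i)" for i
  define u where "u i = a i - p i" for i
  define v where "v i = b i - p i" for i
  define m where "m = (\<Sum>i\<in>I. u i)"
  have m_v: "m = (\<Sum>i\<in>I. v i)"
    using sum_a sum_b by (simp add: m_def u_def v_def sum_subtractf)
  have u0: "0 \<le> u i" and v0: "0 \<le> v i" for i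
    by (auto simp: u_def v_def p_def)
  have m0: "0 \<le> m"
    unfolding m_def by (intro sum_nonneg u0)
  define G where "G i j = of_bool (i = j) * p i / (a i * b i) + (u i / a i) * (v j / b j) / m" for i j
  \<comment> \<open>Division by zero is harmless below: \<open>a i = 0\<close> forces \<open>p i = u i = 0\<close>, likewise for \<open>b\<close> and \<open>v\<close>,
    and \<open>m = 0\<close> forces all \<open>u i\<close> and \<open>v i\<close> to vanish.\<close>
  have ua: "u i / a i * a i = u i" if "i \<in> I" for i
    using a0[OF that] b0[OF that] by (auto simp: u_def p_def)
  have vb: "v i / b i * b i = v i" if "i \<in> I" for i
    using a0[OF that] b0[OF that] by (auto simp: v_def p_def)
  have pa: "p i / (a i * b i) * b i = p i / a i" and pb: "p i / (a i * b i) * a i = p i / b i"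
    if "i \<in> I" for i
    using a0[OF that] b0[OF that] by (auto simp: p_def)
  have um: "u i * (m / m) = u i" and vm: "v i * (m / m) = v i" if "i \<in> I" for i
  proof -
    have "u i = 0 \<and> v i = 0" if "m = 0"
      using that fin u0 v0 \<open>i \<in> I\<close> by (metis m_def m_v sum_nonneg_0)
    then show "u i * (m / m) = u i" "v i * (m / m) = v i"
      by (cases "m = 0"; simp)+
  qed
  have split_b: "(\<Sum>j\<in>I. G i j * b j) = p i / a i + u i / a i" if "i \<in> I" for i
  proof -
    have "(\<Sum>j\<in>I. G i j * b j)
        = (\<Sum>j\<in>I. (if i = j then p i / a i else 0) + (u i / a i / m) * v j)"
      by (intro sum.cong refl)
        (use pa vb in \<open>auto simp: G_def distrib_right mult.assoc
          simp del: times_divide_eq_right\<close>)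
    also have "\<dots> = p i / a i + (u i / a i / m) * m"
      using fin that by (simp add: sum.distrib m_v sum_distrib_left)
    also have "(u i / a i / m) * m = u i * (m / m) / a i"
      by simp
    finally show ?thesis
      by (simp only: um[OF that])
  qed
  have split_a: "(\<Sum>i\<in>I. G i j * a i) = p j / b j + v j / b j" if "j \<in> I" for j
  proof -
    have "(\<Sum>i\<in>I. G i j * a i)
        = (\<Sum>i\<in>I. (if i = j then p j / b j else 0) + (v j / b j / m) * u i)"
    proof (intro sum.cong refl)
      fix i assume i: "i \<in> I"
      have "(u i / a i) * (v j / b j) / m * a i = (v j / b j / m) * (u i / a i * a i)"
        by simp
      then show "G i j * a i = (if i = j then p j / b j else 0) + (v j / b j / m) * u i"
        using pb[OF i] ua[OF i] by (auto simp: G_def distrib_right)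
    qed
    also have "\<dots> = p j / b j + (v j / b j / m) * m"
      using fin that by (simp add: sum.distrib m_def sum_distrib_left)
    also have "(v j / b j / m) * m = v j * (m / m) / b j"
      by simp
    finally show ?thesis
      by (simp only: vm[OF that])
  qed
  show thesis
  proof (rule that[of G])
    fix i j assume "i \<in> I" "j \<in> I"
    then show "0 \<le> G i j"
      using a0 b0 u0 v0 m0 by (auto simp: G_def p_def)
  next
    fix i assume "i \<in> I" "a i > 0"
    then show "(\<Sum>j\<in>I. G i j * b j) = 1"
      by (simp add: split_b u_def add_divide_distrib[symmetric])
  next
    fix j assume "j \<in> I" "b j > 0"
    then show "(\<Sum>i\<in>I. G i j * a i) = 1"
      by (simp add: split_a v_def add_divide_distrib[symmetric])
  next
    have "(\<Sum>i\<in>I. (\<Sum>j\<in>I. of_bool (i \<noteq> j) * G i j * b j) * a i)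
        \<le> (\<Sum>i\<in>I. (\<Sum>j\<in>I. (u i / a i / m) * v j) * a i)"
    proof (intro sum_mono mult_right_mono a0)
      fix i j assume ij: "i \<in> I" "j \<in> I"
      have "of_bool (i \<noteq> j) * G i j * b j = of_bool (i \<noteq> j) * ((u i / a i / m) * (v j / b j * b j))"
        by (simp add: G_def)
      also have "\<dots> = of_bool (i \<noteq> j) * ((u i / a i / m) * v j)"
        by (simp only: vb[OF ij(2)])
      also have "\<dots> \<le> (u i / a i / m) * v j"
        using u0 v0 m0 a0[OF ij(1)] by auto
      finally show "of_bool (i \<noteq> j) * G i j * b j \<le> (u i / a i / m) * v j" .
    qed
    also have "\<dots> = (\<Sum>i\<in>I. u i)"
    proof (intro sum.cong refl)
      fix i assume i: "i \<in> I"
      have "(\<Sum>j\<in>I. (u i / a i / m) * v j) = (u i / a i / m) * m"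
        by (simp only: m_v sum_distrib_left)
      then have "(\<Sum>j\<in>I. (u i / a i / m) * v j) * a i = (u i / a i * a i) * (m / m)"
        by simp
      then show "(\<Sum>j\<in>I. (u i / a i / m) * v j) * a i = u i"
        by (simp only: ua[OF i] um[OF i])
    qed
    also have "\<dots> \<le> (\<Sum>i\<in>I. \<bar>a i - b i\<bar>)"
      by (intro sum_mono) (auto simp: u_def p_def)
    finally show "(\<Sum>i\<in>I. (\<Sum>j\<in>I. of_bool (i \<noteq> j) * G i j * b j) * a i)
        \<le> (\<Sum>i\<in>I. \<bar>a i - b i\<bar>)" .
  qed
qed

lemma nn_integral_finite_label:
  assumes "finite_measure \<alpha>" and c: "c \<in> \<alpha> \<rightarrow>\<^sub>M count_space I" and fin: "finite I"
    and \<phi>: "\<And>i. i \<in> I \<Longrightarrow> 0 \<le> (\<phi> i :: real)"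
  shows "(\<integral>\<^sup>+x. ennreal (\<phi> (c x)) \<partial>\<alpha>)
    = ennreal (\<Sum>i\<in>I. \<phi> i * measure \<alpha> (c -` {i} \<inter> space \<alpha>))"
proof -
  interpret finite_measure \<alpha> by fact
  have S: "c -` {i} \<inter> space \<alpha> \<in> sets \<alpha>" if "i \<in> I" for i
    using c that by (auto intro: measurable_sets)
  have "(\<integral>\<^sup>+x. ennreal (\<phi> (c x)) \<partial>\<alpha>)
      = (\<integral>\<^sup>+x. (\<Sum>i\<in>I. ennreal (\<phi> i) * indicator (c -` {i} \<inter> space \<alpha>) x) \<partial>\<alpha>)"
  proof (intro nn_integral_cong)
    fix x assume x: "x \<in> space \<alpha>"
    then have "c x \<in> I"
      using measurable_space[OF c] by auto
    have "(\<Sum>i\<in>I. ennreal (\<phi> i) * indicator (c -` {i} \<inter> space \<alpha>) x)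
        = (\<Sum>i\<in>I. if i = c x then ennreal (\<phi> i) else 0)"
      using x by (intro sum.cong) (auto simp: indicator_def)
    then show "ennreal (\<phi> (c x))
        = (\<Sum>i\<in>I. ennreal (\<phi> i) * indicator (c -` {i} \<inter> space \<alpha>) x)"
      using fin \<open>c x \<in> I\<close> by simp
  qed
  also have "\<dots> = (\<Sum>i\<in>I. ennreal (\<phi> i) * emeasure \<alpha> (c -` {i} \<inter> space \<alpha>))"
    using S by (subst nn_integral_sum) (auto simp: nn_integral_cmult_indicator)
  also have "\<dots> = (\<Sum>i\<in>I. ennreal (\<phi> i * measure \<alpha> (c -` {i} \<inter> space \<alpha>)))"
    by (intro sum.cong refl) (simp add: emeasure_eq_measure ennreal_mult'' )
  also have "\<dots> = ennreal (\<Sum>i\<in>I. \<phi> i * measure \<alpha> (c -` {i} \<inter> space \<alpha>))"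
    using \<phi> by (subst sum_ennreal) auto
  finally show ?thesis .
qed

lemma AE_label_positive:
  assumes "finite_measure \<alpha>" and c: "c \<in> \<alpha> \<rightarrow>\<^sub>M count_space I" and fin: "finite I"
  shows "AE x in \<alpha>. 0 < measure \<alpha> (c -` {c x} \<inter> space \<alpha>)"
proof -
  interpret finite_measure \<alpha> by fact
  have "AE x in \<alpha>. \<forall>i\<in>I. c x = i \<longrightarrow> 0 < measure \<alpha> (c -` {i} \<inter> space \<alpha>)"
  proof (intro AE_finite_allI fin)
    fix i assume i: "i \<in> I"
    have S: "c -` {i} \<inter> space \<alpha> \<in> sets \<alpha>"
      using c i by (auto intro: measurable_sets)
    show "AE x in \<alpha>. c x = i \<longrightarrow> 0 < measure \<alpha> (c -` {i} \<inter> space \<alpha>)"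
    proof (cases "measure \<alpha> (c -` {i} \<inter> space \<alpha>) = 0")
      case True
      with S have "c -` {i} \<inter> space \<alpha> \<in> null_sets \<alpha>"
        by (simp add: null_setsI emeasure_eq_measure)
      then have "AE x in \<alpha>. x \<notin> c -` {i} \<inter> space \<alpha>"
        by (rule AE_not_in)
      with AE_space show ?thesis
        by eventually_elim auto
    qed (auto simp: less_le)
  qed
  with AE_space show ?thesis
    by eventually_elim (use measurable_space[OF c] in auto)
qed

lemma sum_measure_labels:
  assumes "prob_space \<alpha>" and c: "c \<in> \<alpha> \<rightarrow>\<^sub>M count_space I" and fin: "finite I"
  shows "(\<Sum>i\<in>I. measure \<alpha> (c -` {i} \<inter> space \<alpha>)) = 1"
proof -
  interpret prob_space \<alpha> by fact
  have "ennreal (\<Sum>i\<in>I. 1 * measure \<alpha> (c -` {i} \<inter> space \<alpha>)) = ennreal 1"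
    by (subst nn_integral_finite_label[OF finite_measure_axioms c fin, symmetric])
      (simp_all add: emeasure_space_1)
  then show ?thesis
    by (simp add: sum_nonneg)
qed

text \<open>
  Two probability spaces whose points carry labels in a finite set admit a coupling under which the
  labels differ with probability at most \<open>\<Sum>\<bar>a i - b i\<bar>\<close>, where \<open>a\<close> and \<open>b\<close> are the label distributions:
  use the maximal coupling of the labels as a density with respect to the product measure, so that
  the points are independent given their labels.
\<close>

lemma coupling_of_labels:
  fixes \<alpha> :: "'a measure" and \<beta> :: "'b measure" and c :: "'a \<Rightarrow> 'i" and c' :: "'b \<Rightarrow> 'i"
  assumes "prob_space \<alpha>" "prob_space \<beta>" and fin: "finite I"
    and c: "c \<in> \<alpha> \<rightarrow>\<^sub>M count_space I" and c': "c' \<in> \<beta> \<rightarrow>\<^sub>M count_space I"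
  obtains \<pi> where "\<pi> \<in> couplings \<alpha> \<beta>"
    and "measure \<pi> {z \<in> space \<pi>. c (fst z) \<noteq> c' (snd z)}
      \<le> (\<Sum>i\<in>I. \<bar>measure \<alpha> (c -` {i} \<inter> space \<alpha>) - measure \<beta> (c' -` {i} \<inter> space \<beta>)\<bar>)"
proof -
  interpret A: prob_space \<alpha> by fact
  interpret B: prob_space \<beta> by fact
  interpret AB: pair_prob_space \<alpha> \<beta> ..
  define a where "a i = measure \<alpha> (c -` {i} \<inter> space \<alpha>)" for i
  define b where "b i = measure \<beta> (c' -` {i} \<inter> space \<beta>)" for i
  have "sum a I = 1" "sum b I = 1"
    unfolding a_def b_def
    by (rule sum_measure_labels[OF assms(1) c fin] sum_measure_labels[OF assms(2) c' fin])+
  then obtain G where G0: "\<And>i j. i \<in> I \<Longrightarrow> j \<in> I \<Longrightarrow> 0 \<le> G i j"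
    and Gb: "\<And>i. i \<in> I \<Longrightarrow> a i > 0 \<Longrightarrow> (\<Sum>j\<in>I. G i j * b j) = 1"
    and Ga: "\<And>j. j \<in> I \<Longrightarrow> b j > 0 \<Longrightarrow> (\<Sum>i\<in>I. G i j * a i) = 1"
    and Gle: "(\<Sum>i\<in>I. (\<Sum>j\<in>I. of_bool (i \<noteq> j) * G i j * b j) * a i) \<le> (\<Sum>i\<in>I. \<bar>a i - b i\<bar>)"
    using discrete_coupling_kernel[OF fin, of a b] by (auto simp: a_def b_def)
  have cI: "c x \<in> I" if "x \<in> space \<alpha>" for x
    using measurable_space[OF c that] by simp
  have c'I: "c' x \<in> I" if "x \<in> space \<beta>" for x
    using measurable_space[OF c' that] by simp
  have lab: "(\<lambda>z. (c (fst z), c' (snd z))) \<in> \<alpha> \<Otimes>\<^sub>M \<beta> \<rightarrow>\<^sub>M count_space (I \<times> I)"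
  proof -
    have "(\<lambda>z. (c (fst z), c' (snd z))) \<in> \<alpha> \<Otimes>\<^sub>M \<beta> \<rightarrow>\<^sub>M count_space I \<Otimes>\<^sub>M count_space I"
      using c c' by measurable
    then show ?thesis
      using fin by (simp add: pair_measure_countable countable_finite)
  qed
  have meas: "(\<lambda>z. ennreal (H (c (fst z)) (c' (snd z)))) \<in> borel_measurable (\<alpha> \<Otimes>\<^sub>M \<beta>)" for H
    using measurable_compose[OF lab, of "\<lambda>(i, j). ennreal (H i j)" borel] by simp
  have meas': "{z \<in> space (\<alpha> \<Otimes>\<^sub>M \<beta>). c (fst z) \<noteq> c' (snd z)} \<in> sets (\<alpha> \<Otimes>\<^sub>M \<beta>)"
    using measurable_sets_Collect[OF lab, of "\<lambda>(i, j). i \<noteq> j"] by (simp add: split_def)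
  define \<pi> where "\<pi> = density (\<alpha> \<Otimes>\<^sub>M \<beta>) (\<lambda>z. ennreal (G (c (fst z)) (c' (snd z))))"
  have sets_\<pi>: "sets \<pi> = sets (\<alpha> \<Otimes>\<^sub>M \<beta>)" and space_\<pi>: "space \<pi> = space (\<alpha> \<Otimes>\<^sub>M \<beta>)"
    by (simp_all add: \<pi>_def)
  have em: "emeasure \<pi> X = (\<integral>\<^sup>+z. ennreal (G (c (fst z)) (c' (snd z))) * indicator X z \<partial>(\<alpha> \<Otimes>\<^sub>M \<beta>))"
    if "X \<in> sets (\<alpha> \<Otimes>\<^sub>M \<beta>)" for X
    unfolding \<pi>_def by (rule emeasure_density[OF meas that])
  have row: "(\<integral>\<^sup>+y. ennreal (H (c x) (c' y)) \<partial>\<beta>) = ennreal (\<Sum>j\<in>I. H (c x) j * b j)"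
    if "x \<in> space \<alpha>" "\<And>i j. i \<in> I \<Longrightarrow> j \<in> I \<Longrightarrow> 0 \<le> H i j" for H x
    unfolding b_def using that cI
    by (intro nn_integral_finite_label[OF B.finite_measure_axioms c' fin]) auto
  have fst: "distr \<pi> \<alpha> fst = \<alpha>"
  proof (rule measure_eqI)
    fix X assume "X \<in> sets (distr \<pi> \<alpha> fst)"
    then have X: "X \<in> sets \<alpha>" by simp
    have "emeasure (distr \<pi> \<alpha> fst) X = emeasure \<pi> (fst -` X \<inter> space (\<alpha> \<Otimes>\<^sub>M \<beta>))"
      using X by (subst emeasure_distr) (auto simp: space_\<pi> measurable_cong_sets[OF sets_\<pi> refl])
    also have "\<dots> = (\<integral>\<^sup>+z. ennreal (G (c (fst z)) (c' (snd z)))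
        * indicator (fst -` X \<inter> space (\<alpha> \<Otimes>\<^sub>M \<beta>)) z \<partial>(\<alpha> \<Otimes>\<^sub>M \<beta>))"
      using X by (intro em) measurable
    also have "\<dots> = (\<integral>\<^sup>+z. ennreal (G (c (fst z)) (c' (snd z))) * indicator X (fst z) \<partial>(\<alpha> \<Otimes>\<^sub>M \<beta>))"
      by (intro nn_integral_cong) (auto simp: indicator_def)
    also have "\<dots> = (\<integral>\<^sup>+x. \<integral>\<^sup>+y. ennreal (G (c x) (c' y)) * indicator X x \<partial>\<beta> \<partial>\<alpha>)"
      using X meas by (subst B.nn_integral_fst[symmetric]) auto
    also have "\<dots> = (\<integral>\<^sup>+x. indicator X x \<partial>\<alpha>)"
    proof (rule nn_integral_cong_AE)
      show "AE x in \<alpha>. (\<integral>\<^sup>+y. ennreal (G (c x) (c' y)) * indicator X x \<partial>\<beta>) = indicator X x"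
        using AE_label_positive[OF A.finite_measure_axioms c fin] AE_space
      proof eventually_elim
        case (elim x)
        have "(\<integral>\<^sup>+y. ennreal (G (c x) (c' y)) * indicator X x \<partial>\<beta>)
            = (\<integral>\<^sup>+y. ennreal (G (c x) (c' y)) \<partial>\<beta>) * indicator X x"
          using elim c' by (intro nn_integral_multc) (auto intro: measurable_compose[OF c'])
        also have "(\<integral>\<^sup>+y. ennreal (G (c x) (c' y)) \<partial>\<beta>) = 1"
          using elim by (subst row[of x G]) (auto simp: G0 Gb cI a_def)
        finally show ?case by simp
      qed
    qed
    also have "\<dots> = emeasure \<alpha> X"
      using X by simp
    finally show "emeasure (distr \<pi> \<alpha> fst) X = emeasure \<alpha> X" .
  qed simp
  have snd: "distr \<pi> \<beta> snd = \<beta>"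
  proof (rule measure_eqI)
    fix X assume "X \<in> sets (distr \<pi> \<beta> snd)"
    then have X: "X \<in> sets \<beta>" by simp
    have "emeasure (distr \<pi> \<beta> snd) X = emeasure \<pi> (snd -` X \<inter> space (\<alpha> \<Otimes>\<^sub>M \<beta>))"
      using X by (subst emeasure_distr) (auto simp: space_\<pi> measurable_cong_sets[OF sets_\<pi> refl])
    also have "\<dots> = (\<integral>\<^sup>+z. ennreal (G (c (fst z)) (c' (snd z)))
        * indicator (snd -` X \<inter> space (\<alpha> \<Otimes>\<^sub>M \<beta>)) z \<partial>(\<alpha> \<Otimes>\<^sub>M \<beta>))"
      using X by (intro em) measurable
    also have "\<dots> = (\<integral>\<^sup>+z. ennreal (G (c (fst z)) (c' (snd z))) * indicator X (snd z) \<partial>(\<alpha> \<Otimes>\<^sub>M \<beta>))"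
      by (intro nn_integral_cong) (auto simp: indicator_def)
    also have "\<dots> = (\<integral>\<^sup>+y. \<integral>\<^sup>+x. ennreal (G (c x) (c' y)) * indicator X y \<partial>\<alpha> \<partial>\<beta>)"
      using X meas by (subst AB.nn_integral_snd[symmetric]) (auto simp: split_def)
    also have "\<dots> = (\<integral>\<^sup>+y. indicator X y \<partial>\<beta>)"
    proof (rule nn_integral_cong_AE)
      show "AE y in \<beta>. (\<integral>\<^sup>+x. ennreal (G (c x) (c' y)) * indicator X y \<partial>\<alpha>) = indicator X y"
        using AE_label_positive[OF B.finite_measure_axioms c' fin] AE_space
      proof eventually_elim
        case (elim y)
        have "(\<integral>\<^sup>+x. ennreal (G (c x) (c' y)) * indicator X y \<partial>\<alpha>)
            = (\<integral>\<^sup>+x. ennreal (G (c x) (c' y)) \<partial>\<alpha>) * indicator X y"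
          using elim c by (intro nn_integral_multc) (auto intro: measurable_compose[OF c])
        also have "(\<integral>\<^sup>+x. ennreal (G (c x) (c' y)) \<partial>\<alpha>) = ennreal (\<Sum>i\<in>I. G i (c' y) * a i)"
          unfolding a_def using G0 c'I elim
          by (intro nn_integral_finite_label[OF A.finite_measure_axioms c fin]) auto
        also have "(\<Sum>i\<in>I. G i (c' y) * a i) = 1"
          using elim by (intro Ga) (auto simp: c'I b_def)
        finally show ?case by simp
      qed
    qed
    also have "\<dots> = emeasure \<beta> X"
      using X by simp
    finally show "emeasure (distr \<pi> \<beta> snd) X = emeasure \<beta> X" .
  qed simp
  let ?D = "{z \<in> space \<pi>. c (fst z) \<noteq> c' (snd z)}"
  have "emeasure \<pi> ?D = (\<integral>\<^sup>+z. ennreal (of_bool (c (fst z) \<noteq> c' (snd z)) * G (c (fst z)) (c' (snd z)))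
      \<partial>(\<alpha> \<Otimes>\<^sub>M \<beta>))"
    using meas' by (auto simp: em space_\<pi> indicator_def intro!: nn_integral_cong)
  also have "\<dots> = (\<integral>\<^sup>+x. \<integral>\<^sup>+y. ennreal (of_bool (c x \<noteq> c' y) * G (c x) (c' y)) \<partial>\<beta> \<partial>\<alpha>)"
    using meas[of "\<lambda>i j. of_bool (i \<noteq> j) * G i j"] by (subst B.nn_integral_fst[symmetric]) auto
  also have "\<dots> = (\<integral>\<^sup>+x. ennreal (\<Sum>j\<in>I. of_bool (c x \<noteq> j) * G (c x) j * b j) \<partial>\<alpha>)"
    by (intro nn_integral_cong row[of _ "\<lambda>i j. of_bool (i \<noteq> j) * G i j"])
      (auto simp: G0)
  also have "\<dots> = ennreal (\<Sum>i\<in>I. (\<Sum>j\<in>I. of_bool (i \<noteq> j) * G i j * b j) * a i)"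
    unfolding a_def
    by (intro nn_integral_finite_label[OF A.finite_measure_axioms c fin,
          where \<phi> = "\<lambda>i. \<Sum>j\<in>I. of_bool (i \<noteq> j) * G i j * b j"])
      (auto intro!: sum_nonneg simp: G0 b_def)
  also have "\<dots> \<le> ennreal (\<Sum>i\<in>I. \<bar>a i - b i\<bar>)"
    using Gle by (rule ennreal_leI)
  finally have "measure \<pi> ?D \<le> (\<Sum>i\<in>I. \<bar>a i - b i\<bar>)"
    unfolding measure_def by (intro enn2real_leI) (auto intro: sum_nonneg)
  then show thesis
    using fst snd sets_\<pi> by (intro that[of \<pi>]) (auto simp: couplings_def a_def b_def)
qed

section \<open>Geodesic distance and chordal distance\<close>

lemma cos_lipschitz: "\<bar>cos a - cos b\<bar> \<le> \<bar>a - b\<bar>" for a b :: real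
proof -
  have "\<bar>cos a - cos b\<bar> = 2 * \<bar>sin ((a + b) / 2)\<bar> * \<bar>sin ((b - a) / 2)\<bar>"
    by (simp add: cos_diff_cos abs_mult)
  also have "\<dots> \<le> 2 * 1 * \<bar>(b - a) / 2\<bar>"
    by (intro mult_mono abs_sin_le_one abs_sin_x_le_abs_x) auto
  finally show ?thesis by simp
qed

lemma sin_lipschitz: "\<bar>sin a - sin b\<bar> \<le> \<bar>a - b\<bar>" for a b :: real
  using cos_lipschitz[of "pi / 2 - a" "pi / 2 - b"] by (simp add: cos_sin_eq[symmetric] sin_cos_eq)

lemma half_le_sin:
  fixes u :: real
  assumes "0 \<le> u" "u \<le> pi / 2"
  shows "u / 2 \<le> sin u"
proof -
  have "u \<le> 1.7"
    using assms pi_less_4 pi_approx by simp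
  then have "u * u \<le> 1.7 * 1.7"
    using assms by (intro mult_mono) auto
  then have "u * (u * u) \<le> u * 3"
    using assms by (intro mult_left_mono) auto
  moreover have "\<bar>sin u - (\<Sum>m<3. sin_coeff m * u ^ m)\<bar> \<le> inverse (fact 3) * \<bar>u\<bar> ^ 3"
    by (rule Maclaurin_sin_bound)
  then have "\<bar>sin u - u\<bar> \<le> u ^ 3 / 6"
    using assms by (simp add: sin_coeff_def numeral_3_eq_3 fact_numeral)
  then have "\<bar>sin u - u\<bar> \<le> u * (u * u) / 6"
    by (simp only: power3_eq_cube mult.assoc)
  ultimately show ?thesis
    by linarith
qed

lemma inner_S2_bounds: "x \<in> S2 \<Longrightarrow> y \<in> S2 \<Longrightarrow> x \<bullet> y \<in> {-1..1}"
  using Cauchy_Schwarz_ineq2[of x y] by (simp add: S2_def abs_le_iff)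

lemma geodesic_dist_bounds:
  assumes "x \<in> S2" "y \<in> S2"
  shows "0 \<le> geodesic_dist x y" "geodesic_dist x y \<le> pi"
  using inner_S2_bounds[OF assms] by (simp_all add: geodesic_dist_def arccos_lbound arccos_ubound)

text \<open>
  If \<open>d\<close> is the geodesic distance, the chord has length \<open>2 * sin (d / 2)\<close>, which \<open>half_le_sin\<close>
  compares with \<open>d / 2\<close>.
\<close>

lemma geodesic_dist_le_norm:
  assumes "x \<in> S2" "y \<in> S2"
  shows "geodesic_dist x y \<le> 2 * norm (x - y)"
proof -
  define u where "u = geodesic_dist x y / 2"
  have u: "0 \<le> u" "u \<le> pi / 2"
    using geodesic_dist_bounds[OF assms] by (auto simp: u_def)
  have "cos (2 * u) = x \<bullet> y"
    using inner_S2_bounds[OF assms] by (simp add: u_def geodesic_dist_def)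
  then have "(norm (x - y))\<^sup>2 = (2 * sin u)\<^sup>2"
    using assms cos_double_sin[of u]
    by (simp add: dot_norm_neg S2_def power_mult_distrib)
  then have "norm (x - y) = 2 * sin u"
    by (rule power2_eq_imp_eq) (use u in \<open>auto intro!: sin_ge_zero\<close>)
  then show ?thesis
    using half_le_sin[OF u] by (simp add: u_def)
qed

section \<open>A partition of the sphere into small cells\<close>

text \<open>
  Label of a point of the sphere: its colatitude, rounded down to the grid of mesh \<open>\<eta>\<close>, its longitude
  folded to \<open>[0, pi]\<close> (the angle to the first axis within the first two coordinates), rounded in the
  same way, and the sign of the second coordinate, which undoes the folding. At the poles the quotient
  is \<open>0 / 0 = 0\<close>, which assigns them the folded longitude \<open>pi / 2\<close>.
\<close>

definition spherical_cell :: "real \<Rightarrow> real^3 \<Rightarrow> int \<times> int \<times> bool" where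
  "spherical_cell \<eta> x =
    (\<lfloor>arccos (x $ 3) / \<eta>\<rfloor>, \<lfloor>arccos (x $ 1 / sqrt ((x $ 1)\<^sup>2 + (x $ 2)\<^sup>2)) / \<eta>\<rfloor>, 0 \<le> x $ 2)"

lemma S2_components: "x \<in> S2 \<longleftrightarrow> (x $ 1)\<^sup>2 + (x $ 2)\<^sup>2 + (x $ 3)\<^sup>2 = 1" for x :: "real^3"
  by (simp add: S2_def norm_eq_1 inner_vec_def sum_3 power2_eq_square)

lemma abs_divide_hypot_le_1: "a / sqrt (a\<^sup>2 + b\<^sup>2) \<in> {-1..1}" for a b :: real
proof -
  have "\<bar>a\<bar> \<le> sqrt (a\<^sup>2 + b\<^sup>2)"
    by (rule real_le_rsqrt) simp
  then have "\<bar>a / sqrt (a\<^sup>2 + b\<^sup>2)\<bar> \<le> 1"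
    by (auto simp: divide_le_eq abs_divide not_sum_power2_lt_zero)
  then show ?thesis
    by (metis abs_le_iff atLeastAtMost_iff minus_le_iff)
qed

lemma spherical_coordinates:
  fixes x :: "real^3"
  assumes "x \<in> S2"
  defines "\<theta> \<equiv> arccos (x $ 3)" and "\<phi> \<equiv> arccos (x $ 1 / sqrt ((x $ 1)\<^sup>2 + (x $ 2)\<^sup>2))"
  shows "0 \<le> \<theta>" "\<theta> \<le> pi" "0 \<le> \<phi>" "\<phi> \<le> pi"
    and "x $ 3 = cos \<theta>" "x $ 1 = sin \<theta> * cos \<phi>"
    and "x $ 2 = (if 0 \<le> x $ 2 then 1 else - 1) * (sin \<theta> * sin \<phi>)"
proof -
  let ?r = "sqrt ((x $ 1)\<^sup>2 + (x $ 2)\<^sup>2)"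
  have r: "?r\<^sup>2 = (x $ 1)\<^sup>2 + (x $ 2)\<^sup>2"
    by simp
  have x3: "(x $ 3)\<^sup>2 = 1 - ?r\<^sup>2"
    using assms(1) by (simp add: S2_components)
  have "\<bar>x $ 3\<bar> \<le> 1"
    using x3 by (intro abs_le_square_iff[THEN iffD2, of _ 1, simplified]) simp
  then have *: "-1 \<le> x $ 3" "x $ 3 \<le> 1"
    by auto
  note ** = abs_divide_hypot_le_1[of "x $ 1" "x $ 2", simplified]
  show \<theta>: "0 \<le> \<theta>" "\<theta> \<le> pi" and \<phi>: "0 \<le> \<phi>" "\<phi> \<le> pi"
    using * ** by (auto simp: \<theta>_def \<phi>_def arccos_lbound arccos_ubound)
  show c: "x $ 3 = cos \<theta>"
    using * by (simp add: \<theta>_def)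
  have s: "sin \<theta> = ?r"
    using * x3 by (simp add: \<theta>_def sin_arccos)
  have c\<phi>: "cos \<phi> = x $ 1 / ?r"
    using ** by (simp add: \<phi>_def)
  show x1: "x $ 1 = sin \<theta> * cos \<phi>"
    unfolding s c\<phi> by (cases "?r = 0") (auto simp: sum_power2_eq_zero_iff)
  have "(x $ 2)\<^sup>2 = (sin \<theta>)\<^sup>2 - (x $ 1)\<^sup>2"
    unfolding s r by simp
  also have "\<dots> = (sin \<theta> * sin \<phi>)\<^sup>2"
    unfolding x1 by (simp add: power_mult_distrib sin_squared_eq[of \<phi>] algebra_simps)
  finally have "\<bar>x $ 2\<bar> = \<bar>sin \<theta> * sin \<phi>\<bar>"
    by (simp add: power2_eq_iff abs_eq_iff)
  moreover have "0 \<le> sin \<theta> * sin \<phi>"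
    using \<theta> \<phi> by (simp add: sin_ge_zero)
  ultimately show "x $ 2 = (if 0 \<le> x $ 2 then 1 else - 1) * (sin \<theta> * sin \<phi>)"
    by auto
qed

lemma abs_diff_le_of_floor_eq:
  fixes s t \<eta> :: real
  assumes "0 < \<eta>" "\<lfloor>s / \<eta>\<rfloor> = \<lfloor>t / \<eta>\<rfloor>"
  shows "\<bar>s - t\<bar> \<le> \<eta>"
proof -
  have "\<bar>s / \<eta> - t / \<eta>\<bar> \<le> 1"
    using assms(2) floor_correct[of "s / \<eta>"] floor_correct[of "t / \<eta>"] by linarith
  then show ?thesis
    using assms(1) by (simp add: diff_divide_distrib[symmetric] abs_divide divide_le_eq)
qed

lemma abs_mult_diff_le:
  fixes a a' b b' :: real
  assumes "\<bar>a - a'\<bar> \<le> e" "\<bar>b - b'\<bar> \<le> e" "\<bar>b\<bar> \<le> 1" "\<bar>a'\<bar> \<le> 1"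
  shows "\<bar>a * b - a' * b'\<bar> \<le> 2 * e"
proof -
  have "\<bar>a * b - a' * b'\<bar> = \<bar>(a - a') * b + a' * (b - b')\<bar>"
    by (simp add: algebra_simps)
  also have "\<dots> \<le> \<bar>a - a'\<bar> * \<bar>b\<bar> + \<bar>a'\<bar> * \<bar>b - b'\<bar>"
    unfolding abs_mult[symmetric] by (rule abs_triangle_ineq)
  also have "\<dots> \<le> e * 1 + 1 * e"
    using assms by (intro add_mono mult_mono) auto
  finally show ?thesis by simp
qed

lemma geodesic_dist_spherical_cell:
  assumes xy: "x \<in> S2" "y \<in> S2" and \<eta>: "0 < \<eta>"
    and eq: "spherical_cell \<eta> x = spherical_cell \<eta> y"
  shows "geodesic_dist x y \<le> 10 * \<eta>"
proof -
  define \<theta> where "\<theta> z = arccos (z $ 3)" for z :: "real^3"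
  define \<phi> where "\<phi> z = arccos (z $ 1 / sqrt ((z $ 1)\<^sup>2 + (z $ 2)\<^sup>2))" for z :: "real^3"
  note sx = spherical_coordinates[OF xy(1), folded \<theta>_def \<phi>_def]
  note sy = spherical_coordinates[OF xy(2), folded \<theta>_def \<phi>_def]
  have \<theta>: "\<bar>\<theta> x - \<theta> y\<bar> \<le> \<eta>" and \<phi>: "\<bar>\<phi> x - \<phi> y\<bar> \<le> \<eta>" and sgn: "0 \<le> x $ 2 \<longleftrightarrow> 0 \<le> y $ 2"
    using eq by (auto simp: spherical_cell_def \<theta>_def \<phi>_def intro!: abs_diff_le_of_floor_eq[OF \<eta>])
  note lip = order_trans[OF cos_lipschitz \<theta>] order_trans[OF sin_lipschitz \<theta>]
    order_trans[OF cos_lipschitz \<phi>] order_trans[OF sin_lipschitz \<phi>]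
  have "\<bar>x $ 3 - y $ 3\<bar> \<le> \<eta>"
    unfolding sx(5) sy(5) by (rule lip)
  moreover have "\<bar>x $ 1 - y $ 1\<bar> \<le> 2 * \<eta>"
    unfolding sx(6) sy(6) by (intro abs_mult_diff_le lip) auto
  moreover have "\<bar>x $ 2 - y $ 2\<bar> \<le> 2 * \<eta>"
  proof -
    have "\<bar>x $ 2 - y $ 2\<bar> = \<bar>sin (\<theta> x) * sin (\<phi> x) - sin (\<theta> y) * sin (\<phi> y)\<bar>"
      using sx(7) sy(7) sgn by (auto split: if_splits)
    also have "\<dots> \<le> 2 * \<eta>"
      by (intro abs_mult_diff_le lip) auto
    finally show ?thesis .
  qed
  ultimately have "norm (x - y) \<le> 5 * \<eta>"
    using norm_le_l1_cart[of "x - y"] by (simp add: sum_3)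
  then show ?thesis
    using geodesic_dist_le_norm[OF xy] by simp
qed

text \<open>
  A finite set that contains all labels \<open>spherical_cell \<eta> x\<close> with \<open>x\<close> on the sphere. It may contain
  labels of empty cells.
\<close>

definition spherical_cells :: "real \<Rightarrow> (int \<times> int \<times> bool) set" where
  "spherical_cells \<eta> = {0..\<lfloor>pi / \<eta>\<rfloor>} \<times> {0..\<lfloor>pi / \<eta>\<rfloor>} \<times> UNIV"

lemma finite_spherical_cells [simp]: "finite (spherical_cells \<eta>)"
  by (simp add: spherical_cells_def)

lemma card_spherical_cells:
  assumes "0 < \<eta>" "\<eta> \<le> 1"
  shows "real (card (spherical_cells \<eta>)) \<le> 50 / \<eta>\<^sup>2"
proof -
  have "0 \<le> pi / \<eta>"
    using assms by simp
  then have n: "0 \<le> \<lfloor>pi / \<eta>\<rfloor>"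
    by simp
  have "of_int \<lfloor>pi / \<eta>\<rfloor> + 1 \<le> pi / \<eta> + 1 / \<eta>"
    using assms by (intro add_mono of_int_floor_le) (simp add: le_divide_eq)
  also have "\<dots> \<le> 5 / \<eta>"
    using assms pi_less_4 by (simp add: add_divide_distrib[symmetric] divide_right_mono)
  finally have le: "of_int \<lfloor>pi / \<eta>\<rfloor> + 1 \<le> 5 / \<eta>" .
  have "real (card (spherical_cells \<eta>)) = 2 * (of_int \<lfloor>pi / \<eta>\<rfloor> + 1)\<^sup>2"
    using n by (simp add: spherical_cells_def card_cartesian_product power2_eq_square)
  also have "\<dots> \<le> 2 * (5 / \<eta>)\<^sup>2"
    using le n by (intro mult_left_mono power_mono) auto
  finally show ?thesis
    by (simp add: power_divide)
qed

lemma measurable_arccos_comp: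
  assumes "f \<in> borel_measurable M" and "\<And>x. x \<in> space M \<Longrightarrow> f x \<in> {-1..1}"
  shows "(\<lambda>x. arccos (f x)) \<in> borel_measurable M"
proof (rule measurable_compose[where g = arccos])
  show "f \<in> M \<rightarrow>\<^sub>M restrict_space borel {-1..1}"
    using assms by (intro measurable_restrict_space2) auto
  show "arccos \<in> borel_measurable (restrict_space borel {-1..1})"
    by (intro borel_measurable_continuous_on_restrict continuous_on_arccos')
qed

lemma id_borel_S2: "(\<lambda>x. x) \<in> borel_S2 \<rightarrow>\<^sub>M borel"
  unfolding borel_S2_def by (rule measurable_restrict_space1) simp

lemma measurable_spherical_cell:
  assumes \<eta>: "0 < \<eta>"
  shows "spherical_cell \<eta> \<in> borel_S2 \<rightarrow>\<^sub>M count_space (spherical_cells \<eta>)"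
proof -
  have [measurable]: "(\<lambda>x. x $ i) \<in> borel_measurable borel_S2" for i
    using measurable_compose[OF id_borel_S2, of "\<lambda>x. x $ i" borel]
    by (simp add: borel_measurable_nth)
  have x3: "x $ 3 \<in> {-1..1}" if "x \<in> S2" for x :: "real^3"
    using that component_le_norm_cart[of x 3] by (simp add: S2_def abs_le_iff)
  have [measurable]: "(\<lambda>x. arccos (x $ 3)) \<in> borel_measurable borel_S2"
    by (rule measurable_arccos_comp) (use x3 in auto)
  have [measurable]: "(\<lambda>x. arccos (x $ 1 / sqrt ((x $ 1)\<^sup>2 + (x $ 2)\<^sup>2))) \<in> borel_measurable borel_S2"
    by (rule measurable_arccos_comp) (use abs_divide_hypot_le_1 in auto)
  have "spherical_cell \<eta> \<in> borel_S2 \<rightarrow>\<^sub>M count_space UNIV"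
    unfolding spherical_cell_def by measurable
  moreover have "spherical_cell \<eta> x \<in> spherical_cells \<eta>" if "x \<in> S2" for x
    using spherical_coordinates(1-4)[OF that] \<eta>
    by (auto simp: spherical_cell_def spherical_cells_def intro!: floor_mono divide_right_mono)
  ultimately show ?thesis
    by (auto simp: measurable_count_space_eq2 measurable_def)
qed

section \<open>Elementary properties of the Wasserstein distance and of empirical measures\<close>

lemma W1_le_coupling:
  assumes "prob_space \<alpha>" "sets \<alpha> = sets borel_S2" "sets \<beta> = sets borel_S2"
    and "\<pi> \<in> couplings \<alpha> \<beta>"
  shows "W1 \<alpha> \<beta> \<le> (\<integral>z. geodesic_dist (fst z) (snd z) \<partial>\<pi>)"
  unfolding W1_def
proof (rule cINF_lower)
  show "bdd_below ((\<lambda>\<pi>. \<integral>z. geodesic_dist (fst z) (snd z) \<partial>\<pi>) ` couplings \<alpha> \<beta>)"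
    using integrable_geodesic_dist(3)[OF assms(1-3)] by (intro bdd_belowI2[where m = 0]) auto
qed fact

lemma W1_bounds:
  assumes "prob_space \<alpha>" "prob_space \<beta>" "sets \<alpha> = sets borel_S2" "sets \<beta> = sets borel_S2"
  shows "W1 \<alpha> \<beta> \<in> {0..pi}"
proof -
  note \<pi> = pair_measure_in_couplings[OF assms(1,2)]
  have "0 \<le> W1 \<alpha> \<beta>"
    unfolding W1_def using \<pi> integrable_geodesic_dist(3)[OF assms(1,3,4)]
    by (intro cINF_greatest) auto
  moreover have "W1 \<alpha> \<beta> \<le> pi"
    using W1_le_coupling[OF assms(1,3,4) \<pi>] integrable_geodesic_dist(3)[OF assms(1,3,4) \<pi>]
    by simp
  ultimately show ?thesis
    by simp
qed

lemma measure_empirical: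
  assumes "\<xi> \<in> {1..N} \<rightarrow> S2" "A \<in> sets borel_S2"
  shows "measure (empirical N \<xi>) A = (\<Sum>j = 1..N. indicator A (\<xi> j)) / real N"
proof -
  have "\<xi> \<in> uniform_count_measure {1..N} \<rightarrow>\<^sub>M borel_S2"
    using assms by (auto simp: measurable_def space_uniform_count_measure sets_uniform_count_measure)
  then have "measure (empirical N \<xi>) A = real (card (\<xi> -` A \<inter> {1..N})) / real N"
    using assms
    by (simp add: empirical_def measure_distr space_uniform_count_measure measure_uniform_count_measure)
  also have "real (card (\<xi> -` A \<inter> {1..N})) = (\<Sum>j = 1..N. indicator A (\<xi> j))"
    by (simp add: indicator_def sum.If_cases Int_def vimage_def conj_commute)
  finally show ?thesis .
qed

lemma sets_empirical [simp]: "sets (empirical N \<xi>) = sets borel_S2"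
  and space_empirical [simp]: "space (empirical N \<xi>) = S2"
  by (simp_all add: empirical_def)

lemma prob_space_empirical:
  assumes "N \<ge> 1" "\<xi> \<in> {1..N} \<rightarrow> S2"
  shows "prob_space (empirical N \<xi>)"
proof (rule prob_spaceI)
  have "\<xi> \<in> uniform_count_measure {1..N} \<rightarrow>\<^sub>M borel_S2"
    using assms by (auto simp: measurable_def space_uniform_count_measure sets_uniform_count_measure)
  moreover have "\<xi> -` S2 \<inter> {1..N} = {1..N}"
    using assms by auto
  moreover have "S2 \<in> sets borel_S2"
    by (metis sets.top space_borel_S2)
  ultimately show "emeasure (empirical N \<xi>) (space (empirical N \<xi>)) = 1"
    using assms
    by (simp add: empirical_def emeasure_distr space_uniform_count_measure
        emeasure_uniform_count_measure)
qed

section \<open>Fluctuations of the cell frequencies\<close>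

text \<open>
  The variance of a sum of independent, identically distributed, bounded, centred variables: the
  mixed moments factor and vanish.
\<close>

lemma second_moment_iid_sum:
  fixes Z :: "'a \<Rightarrow> real"
  assumes "prob_space M" and fin: "finite J" and Z[measurable]: "Z \<in> borel_measurable M"
    and bd: "\<And>x. x \<in> space M \<Longrightarrow> \<bar>Z x\<bar> \<le> B" and mean: "(\<integral>x. Z x \<partial>M) = 0"
  shows "integrable (Pi\<^sub>M J (\<lambda>_. M)) (\<lambda>\<xi>. (\<Sum>j\<in>J. Z (\<xi> j))\<^sup>2)"
    and "(\<integral>\<xi>. (\<Sum>j\<in>J. Z (\<xi> j))\<^sup>2 \<partial>Pi\<^sub>M J (\<lambda>_. M)) = real (card J) * (\<integral>x. (Z x)\<^sup>2 \<partial>M)"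
proof -
  interpret M: prob_space M by fact
  interpret P: product_prob_space "\<lambda>_. M" J ..
  have intZ: "integrable M Z"
    using bd by (intro M.integrable_const_bound[where B = B]) auto
  have bd2: "\<bar>Z x * Z y\<bar> \<le> B * B" if "x \<in> space M" "y \<in> space M" for x y
    unfolding abs_mult using bd[OF that(1)] bd[OF that(2)] by (intro mult_mono) auto
  have int2: "integrable M (\<lambda>x. (Z x)\<^sup>2)"
    by (intro M.integrable_const_bound[where B = "B * B"] AE_I2)
      (use bd2 abs_le_D1 in \<open>auto simp: power2_eq_square\<close>)
  have prod: "integrable (Pi\<^sub>M J (\<lambda>_. M)) (\<lambda>\<xi>. Z (\<xi> j) * Z (\<xi> k))" if "j \<in> J" "k \<in> J" for j k
  proof (rule P.integrable_const_bound[where B = "B * B"])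
    have [measurable]: "(\<lambda>\<xi>. \<xi> i) \<in> Pi\<^sub>M J (\<lambda>_. M) \<rightarrow>\<^sub>M M" if "i \<in> J" for i
      using that by (rule measurable_component_singleton)
    show "(\<lambda>\<xi>. Z (\<xi> j) * Z (\<xi> k)) \<in> borel_measurable (Pi\<^sub>M J (\<lambda>_. M))"
      using that by measurable
    show "AE \<xi> in Pi\<^sub>M J (\<lambda>_. M). norm (Z (\<xi> j) * Z (\<xi> k)) \<le> B * B"
      using that by (intro AE_I2) (auto simp: space_PiM PiE_iff intro!: bd2)
  qed
  have cross: "(\<integral>\<xi>. Z (\<xi> j) * Z (\<xi> k) \<partial>Pi\<^sub>M J (\<lambda>_. M)) = (if j = k then \<integral>x. (Z x)\<^sup>2 \<partial>M else 0)"
    if jk: "j \<in> J" "k \<in> J" for j k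
  proof -
    \<comment> \<open>The product of both factors, written over all of \<open>J\<close> so that it covers \<open>j = k\<close> and \<open>j \<noteq> k\<close> alike.\<close>
    define g where "g i x = (if i = j then Z x else 1) * (if i = k then Z x else 1)" for i x
    have "(\<Prod>i\<in>J. g i (\<xi> i)) = Z (\<xi> j) * Z (\<xi> k)" for \<xi>
      using jk fin by (simp add: g_def prod.distrib)
    then have "(\<integral>\<xi>. Z (\<xi> j) * Z (\<xi> k) \<partial>Pi\<^sub>M J (\<lambda>_. M)) = (\<integral>\<xi>. (\<Prod>i\<in>J. g i (\<xi> i)) \<partial>Pi\<^sub>M J (\<lambda>_. M))"
      by simp
    also have "\<dots> = (\<Prod>i\<in>J. \<integral>x. g i x \<partial>M)"
    proof (intro P.product_integral_prod fin)
      show "integrable M (g i)" for i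
        using intZ int2 by (cases "i = j"; cases "i = k") (auto simp: g_def[abs_def] power2_eq_square)
    qed
    also have "\<dots> = (\<Prod>i\<in>J. if i = j then (\<integral>x. g j x \<partial>M) else if i = k then 0 else 1)"
      using mean by (intro prod.cong) (auto simp: g_def M.prob_space)
    also have "\<dots> = (if j = k then \<integral>x. (Z x)\<^sup>2 \<partial>M else 0)"
    proof (cases "j = k")
      case True
      then show ?thesis
        using jk fin by (simp add: g_def power2_eq_square if_distrib cong: if_cong)
    next
      case False
      then show ?thesis
        using jk fin by (auto simp: prod_zero_iff)
    qed
    finally show ?thesis .
  qed
  have sq: "(\<Sum>j\<in>J. Z (\<xi> j))\<^sup>2 = (\<Sum>j\<in>J. \<Sum>k\<in>J. Z (\<xi> j) * Z (\<xi> k))" for \<xi>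
    by (simp add: power2_eq_square sum_product)
  show "integrable (Pi\<^sub>M J (\<lambda>_. M)) (\<lambda>\<xi>. (\<Sum>j\<in>J. Z (\<xi> j))\<^sup>2)"
    unfolding sq using prod by (intro Bochner_Integration.integrable_sum) auto
  show "(\<integral>\<xi>. (\<Sum>j\<in>J. Z (\<xi> j))\<^sup>2 \<partial>Pi\<^sub>M J (\<lambda>_. M)) = real (card J) * (\<integral>x. (Z x)\<^sup>2 \<partial>M)"
    unfolding sq using prod cross fin
    by (simp add: Bochner_Integration.integral_sum Bochner_Integration.integrable_sum)
qed

lemma empirical_variance_le:
  assumes "prob_space \<mu>" and sets: "sets \<mu> = sets borel_S2" and A: "A \<in> sets borel_S2"
    and N: "N \<ge> 1"
  shows "integrable (Pi\<^sub>M {1..N} (\<lambda>_. \<mu>)) (\<lambda>\<xi>. (measure (empirical N \<xi>) A - measure \<mu> A)\<^sup>2)"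
    and "(\<integral>\<xi>. (measure (empirical N \<xi>) A - measure \<mu> A)\<^sup>2 \<partial>Pi\<^sub>M {1..N} (\<lambda>_. \<mu>))
      \<le> measure \<mu> A / real N"
proof -
  interpret prob_space \<mu> by fact
  have space: "space \<mu> = S2"
    using sets_eq_imp_space_eq[OF sets] by simp
  have A'[measurable]: "A \<in> sets \<mu>"
    using A sets by simp
  define Z where "Z x = indicator A x - measure \<mu> A" for x
  have intA: "integrable \<mu> (indicator A :: _ \<Rightarrow> real)"
    by (rule integrable_const_bound[where B = 1]) auto
  have Z: "Z \<in> borel_measurable \<mu>" "(\<integral>x. Z x \<partial>\<mu>) = 0"
    unfolding Z_def using intA by (simp_all add: prob_space)
  have Z1: "\<bar>Z x\<bar> \<le> 1" for x
    using measure_nonneg[of \<mu> A] prob_le_1[of A] unfolding Z_def indicator_def by auto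
  have "(\<integral>x. (Z x)\<^sup>2 \<partial>\<mu>) = (\<integral>x. (1 - 2 * measure \<mu> A) * indicator A x + (measure \<mu> A)\<^sup>2 \<partial>\<mu>)"
    by (intro Bochner_Integration.integral_cong refl)
      (auto simp: Z_def indicator_def power2_eq_square algebra_simps)
  also have "\<dots> = (1 - 2 * measure \<mu> A) * measure \<mu> A + (measure \<mu> A)\<^sup>2"
    using prob_space intA by simp
  also have "\<dots> \<le> measure \<mu> A"
    by (simp add: power2_eq_square algebra_simps)
  finally have Z2: "(\<integral>x. (Z x)\<^sup>2 \<partial>\<mu>) \<le> measure \<mu> A" .
  note mom = second_moment_iid_sum[OF assms(1), of "{1..N}" Z 1]
  have eq: "(measure (empirical N \<xi>) A - measure \<mu> A)\<^sup>2 = (\<Sum>j\<in>{1..N}. Z (\<xi> j))\<^sup>2 / (real N)\<^sup>2"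
    if "\<xi> \<in> space (Pi\<^sub>M {1..N} (\<lambda>_. \<mu>))" for \<xi>
  proof -
    have "\<xi> \<in> {1..N} \<rightarrow> S2"
      using that by (auto simp: space_PiM space)
    then have "measure (empirical N \<xi>) A - measure \<mu> A = (\<Sum>j\<in>{1..N}. Z (\<xi> j)) / real N"
      using A N by (simp add: measure_empirical Z_def sum_subtractf diff_divide_distrib)
    then show ?thesis
      by (simp add: power_divide)
  qed
  show "integrable (Pi\<^sub>M {1..N} (\<lambda>_. \<mu>)) (\<lambda>\<xi>. (measure (empirical N \<xi>) A - measure \<mu> A)\<^sup>2)"
    using mom(1) Z Z1 by (subst Bochner_Integration.integrable_cong[OF refl eq]) auto
  have "(\<integral>\<xi>. (measure (empirical N \<xi>) A - measure \<mu> A)\<^sup>2 \<partial>Pi\<^sub>M {1..N} (\<lambda>_. \<mu>))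
      = real N * (\<integral>x. (Z x)\<^sup>2 \<partial>\<mu>) / (real N)\<^sup>2"
    using mom(2) Z Z1 by (subst Bochner_Integration.integral_cong[OF refl eq]) auto
  also have "\<dots> \<le> measure \<mu> A / real N"
    using Z2 N by (simp add: power2_eq_square divide_right_mono)
  finally show "(\<integral>\<xi>. (measure (empirical N \<xi>) A - measure \<mu> A)\<^sup>2 \<partial>Pi\<^sub>M {1..N} (\<lambda>_. \<mu>))
      \<le> measure \<mu> A / real N" .
qed

section \<open>Continuous dependence of the Wasserstein distance on the sample\<close>

lemma emeasure_empirical_indicator:
  assumes "N \<ge> 1" "\<xi> \<in> {1..N} \<rightarrow> S2" "A \<in> sets borel_S2"
  shows "emeasure (empirical N \<xi>) A = (\<Sum>j = 1..N. indicator A (\<xi> j)) / of_nat N"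
  using assms by (simp add: emeasure_empirical)

lemma singleton_in_borel_S2: "p \<in> S2 \<Longrightarrow> {p} \<in> sets borel_S2"
  by (simp add: sets_borel_S2_iff)

text \<open>
  When the atoms \<open>\<xi> j\<close> of an empirical measure are moved to \<open>\<xi>' j\<close>, a coupling with \<open>\<beta>\<close> can be
  transported along. Several indices may share the atom \<open>\<xi> i\<close> and yet be moved to different points, so
  the mass that \<open>\<pi>\<close> places above an atom is split evenly among the \<open>n i\<close> indices \<open>i\<close> that carry it,
  before each share is moved to its own \<open>\<xi>' i\<close>.
\<close>

lemma move_atoms_coupling:
  assumes N: "N \<ge> 1" and \<xi>: "\<xi> \<in> {1..N} \<rightarrow> S2" and \<xi>': "\<xi>' \<in> {1..N} \<rightarrow> S2"
    and \<beta>: "sets \<beta> = sets borel_S2" and \<pi>: "\<pi> \<in> couplings (empirical N \<xi>) \<beta>"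
    and \<epsilon>: "0 \<le> \<epsilon>"
    and close: "\<And>j y. j \<in> {1..N} \<Longrightarrow> y \<in> S2 \<Longrightarrow> geodesic_dist (\<xi>' j) y \<le> geodesic_dist (\<xi> j) y + \<epsilon>"
  shows "\<exists>\<pi>' \<in> couplings (empirical N \<xi>') \<beta>.
    (\<integral>z. geodesic_dist (fst z) (snd z) \<partial>\<pi>') \<le> (\<integral>z. geodesic_dist (fst z) (snd z) \<partial>\<pi>) + \<epsilon>"
proof -
  let ?J = "{1..N}" and ?d = "\<lambda>z. geodesic_dist (fst z) (snd z)"
  note pr = prob_space_empirical[OF N \<xi>]
  note cost = integrable_geodesic_dist[OF pr sets_empirical \<beta> \<pi>]
  interpret prob_space \<pi> by (rule cost(1))
  have sets_\<pi>: "sets \<pi> = sets (borel_S2 \<Otimes>\<^sub>M borel_S2)"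
    using \<pi> \<beta> by (simp add: couplings_def cong: sets_pair_measure_cong)
  have fst_\<pi>: "distr \<pi> (empirical N \<xi>) fst = empirical N \<xi>" and snd_\<pi>: "distr \<pi> \<beta> snd = \<beta>"
    using \<pi> by (auto simp: couplings_def)
  have space_\<beta>: "space \<beta> = S2"
    using sets_eq_imp_space_eq[OF \<beta>] by simp
  have space_\<pi>: "space \<pi> = S2 \<times> S2"
    using sets_eq_imp_space_eq[OF sets_\<pi>] by (simp add: space_pair_measure)
  note [measurable_cong] = sets_\<pi> \<beta>
  define n where "n i = real (card {j\<in>?J. \<xi> j = \<xi> i})" for i
  define w where "w i x = ennreal (indicator {\<xi> i} x / n i)" for i x
  have n0: "0 < n i" if "i \<in> ?J" for i
    using that by (auto simp: n_def card_gt_0_iff)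
  have \<xi>S[measurable]: "{\<xi> i} \<in> sets borel_S2" if "i \<in> ?J" for i
    using \<xi> that by (auto intro: singleton_in_borel_S2)
  have w_meas[measurable]: "(\<lambda>x. w i x) \<in> borel_measurable borel_S2" if "i \<in> ?J" for i
    using \<xi>S[OF that] unfolding w_def by measurable
  have w_sum: "(\<Sum>i\<in>?J. w i x) = 1" if "x \<in> \<xi> ` ?J" for x
  proof -
    obtain k where k: "k \<in> ?J" "x = \<xi> k"
      using \<open>x \<in> \<xi> ` ?J\<close> by auto
    have "(\<Sum>i\<in>?J. indicator {\<xi> i} x / n i) = (\<Sum>i\<in>?J. if \<xi> i = \<xi> k then 1 / n k else 0)"
      by (intro sum.cong) (auto simp: k n_def indicator_def)
    also have "\<dots> = (\<Sum>i\<in>{i\<in>?J. \<xi> i = \<xi> k}. 1 / n k)"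
      by (rule sum.inter_filter[symmetric]) simp
    also have "\<dots> = n k * (1 / n k)"
      by (simp add: n_def)
    also have "\<dots> = 1"
      using n0[OF k(1)] by simp
    finally show ?thesis
      unfolding w_def by (subst sum_ennreal) (auto simp: n_def)
  qed
  have AE_atom: "AE z in \<pi>. fst z \<in> \<xi> ` ?J"
  proof -
    have im: "\<xi> ` ?J \<in> sets borel_S2"
      using \<xi> by (auto simp: sets_borel_S2_iff intro!: borel_closed finite_imp_closed)
    have "emeasure (empirical N \<xi>) (\<xi> ` ?J) = 1"
      using N by (subst emeasure_empirical_indicator[OF N \<xi> im])
        (simp add: ennreal_of_nat_eq_real_of_nat divide_ennreal)
    then have "AE x in empirical N \<xi>. x \<in> \<xi> ` ?J"
      using im by (intro prob_space.AE_prob_1[OF pr]) (simp add: measure_def)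
    then have "AE x in distr \<pi> (empirical N \<xi>) fst. x \<in> \<xi> ` ?J"
      by (simp only: fst_\<pi>)
    then show ?thesis
      by (rule AE_distrD[rotated]) (simp add: empirical_def)
  qed
  \<comment> \<open>\<open>K\<close> is \<open>\<pi>\<close> together with an index, chosen uniformly among those of the atom \<open>fst z\<close>.\<close>
  define K where "K = density (count_space ?J \<Otimes>\<^sub>M \<pi>) (\<lambda>(i, z). w i (fst z))"
  define move where "move = (\<lambda>(i, z :: (real^3) \<times> (real^3)). (\<xi>' i, snd z))"
  define \<pi>' where "\<pi>' = distr K (borel_S2 \<Otimes>\<^sub>M borel_S2) move"
  have w2[measurable]: "(\<lambda>(i, z). w i (fst z)) \<in> borel_measurable (count_space ?J \<Otimes>\<^sub>M \<pi>)"
    by (intro measurable_pair_measure_countable1 countable_finite) auto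
  have pair_meas: "(\<lambda>z. (\<xi>' i, snd z)) \<in> \<pi> \<rightarrow>\<^sub>M borel_S2 \<Otimes>\<^sub>M borel_S2" if "i \<in> ?J" for i
    using \<xi>' that by (intro measurable_Pair measurable_const) auto
  have move[measurable]: "move \<in> count_space ?J \<Otimes>\<^sub>M \<pi> \<rightarrow>\<^sub>M borel_S2 \<Otimes>\<^sub>M borel_S2"
    unfolding move_def using pair_meas
    by (intro measurable_pair_measure_countable1 countable_finite) auto
  have int_\<pi>': "(\<integral>\<^sup>+z. g z \<partial>\<pi>') = (\<integral>\<^sup>+z. (\<Sum>i\<in>?J. w i (fst z) * g (\<xi>' i, snd z)) \<partial>\<pi>)"
    if g[measurable]: "g \<in> borel_measurable (borel_S2 \<Otimes>\<^sub>M borel_S2)" for g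
  proof -
    have gi[measurable]: "(\<lambda>z. g (\<xi>' i, snd z)) \<in> borel_measurable \<pi>" if "i \<in> ?J" for i
      using pair_meas[OF that] g by (rule measurable_compose)
    have "(\<integral>\<^sup>+z. g z \<partial>\<pi>') = (\<integral>\<^sup>+p. g (move p) \<partial>K)"
      unfolding \<pi>'_def by (rule nn_integral_distr) (use move g in \<open>auto simp: K_def\<close>)
    also have "\<dots> = (\<integral>\<^sup>+p. (\<lambda>(i, z). w i (fst z)) p * g (move p) \<partial>(count_space ?J \<Otimes>\<^sub>M \<pi>))"
      unfolding K_def by (rule nn_integral_density) measurable
    also have "\<dots> = (\<integral>\<^sup>+i. \<integral>\<^sup>+z. (\<lambda>(i, z). w i (fst z)) (i, z) * g (move (i, z)) \<partial>\<pi> \<partial>count_space ?J)"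
      by (rule nn_integral_fst[symmetric]) measurable
    also have "\<dots> = (\<integral>\<^sup>+i. \<integral>\<^sup>+z. w i (fst z) * g (\<xi>' i, snd z) \<partial>\<pi> \<partial>count_space ?J)"
      by (simp add: move_def)
    also have "\<dots> = (\<Sum>i\<in>?J. \<integral>\<^sup>+z. w i (fst z) * g (\<xi>' i, snd z) \<partial>\<pi>)"
      by (rule nn_integral_count_space_finite) simp
    also have "\<dots> = (\<integral>\<^sup>+z. (\<Sum>i\<in>?J. w i (fst z) * g (\<xi>' i, snd z)) \<partial>\<pi>)"
      by (intro nn_integral_sum[symmetric]) measurable
    finally show ?thesis .
  qed
  have sets_\<pi>': "sets \<pi>' = sets (borel_S2 \<Otimes>\<^sub>M borel_S2)"
    by (simp add: \<pi>'_def)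
  note [measurable_cong] = sets_\<pi>'
  have fst_\<pi>': "distr \<pi>' (empirical N \<xi>') fst = empirical N \<xi>'"
  proof (rule measure_eqI)
    fix X assume "X \<in> sets (distr \<pi>' (empirical N \<xi>') fst)"
    then have X[measurable]: "X \<in> sets borel_S2" by simp
    have "emeasure (distr \<pi>' (empirical N \<xi>') fst) X
        = (\<integral>\<^sup>+x. indicator X x \<partial>distr \<pi>' (empirical N \<xi>') fst)"
      by simp
    also have "\<dots> = (\<integral>\<^sup>+z. indicator X (fst z) \<partial>\<pi>')"
      by (rule nn_integral_distr) (auto simp: empirical_def)
    also have "\<dots> = (\<integral>\<^sup>+z. (\<Sum>i\<in>?J. w i (fst z) * indicator X (\<xi>' i)) \<partial>\<pi>)"
      by (subst int_\<pi>') auto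
    also have "\<dots> = (\<Sum>i\<in>?J. (\<integral>\<^sup>+z. w i (fst z) \<partial>\<pi>) * indicator X (\<xi>' i))"
      by (subst nn_integral_sum) (auto simp: nn_integral_multc)
    also have "\<dots> = (\<Sum>i\<in>?J. indicator X (\<xi>' i) / of_nat N)"
    proof (intro sum.cong refl)
      fix i assume i: "i \<in> ?J"
      have "(\<integral>\<^sup>+z. w i (fst z) \<partial>\<pi>) = (\<integral>\<^sup>+x. w i x \<partial>distr \<pi> (empirical N \<xi>) fst)"
        using i by (intro nn_integral_distr[symmetric]) (auto simp: empirical_def)
      also have "\<dots> = (\<integral>\<^sup>+x. ennreal (1 / n i) * indicator {\<xi> i} x \<partial>empirical N \<xi>)"
        unfolding fst_\<pi> by (intro nn_integral_cong) (auto simp: w_def indicator_def)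
      also have "\<dots> = ennreal (1 / n i) * emeasure (empirical N \<xi>) {\<xi> i}"
        using \<xi>S[OF i] by (simp add: nn_integral_cmult_indicator)
      also have "emeasure (empirical N \<xi>) {\<xi> i} = ennreal (n i) / of_nat N"
        using \<xi>S[OF i] by (simp add: emeasure_empirical_indicator[OF N \<xi>] indicator_def n_def
            sum.If_cases Int_def ennreal_of_nat_eq_real_of_nat)
      also have "ennreal (1 / n i) * (ennreal (n i) / of_nat N) = 1 / of_nat N"
        using n0[OF i] by (simp add: ennreal_times_divide ennreal_mult''[symmetric])
      finally show "(\<integral>\<^sup>+z. w i (fst z) \<partial>\<pi>) * indicator X (\<xi>' i) = indicator X (\<xi>' i) / of_nat N"
        by (simp add: indicator_def)
    qed
    also have "\<dots> = emeasure (empirical N \<xi>') X"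
      by (simp add: emeasure_empirical_indicator[OF N \<xi>' X] divide_ennreal_def sum_distrib_right)
    finally show "emeasure (distr \<pi>' (empirical N \<xi>') fst) X = emeasure (empirical N \<xi>') X" .
  qed simp
  have snd_\<pi>': "distr \<pi>' \<beta> snd = \<beta>"
  proof (rule measure_eqI)
    fix X assume "X \<in> sets (distr \<pi>' \<beta> snd)"
    then have X[measurable]: "X \<in> sets borel_S2" using \<beta> by simp
    have "emeasure (distr \<pi>' \<beta> snd) X = (\<integral>\<^sup>+x. indicator X x \<partial>distr \<pi>' \<beta> snd)"
      using \<beta> X by simp
    also have "\<dots> = (\<integral>\<^sup>+z. indicator X (snd z) \<partial>\<pi>')"
      by (rule nn_integral_distr) measurable
    also have "\<dots> = (\<integral>\<^sup>+z. (\<Sum>i\<in>?J. w i (fst z) * indicator X (snd z)) \<partial>\<pi>)"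
      by (subst int_\<pi>') auto
    also have "\<dots> = (\<integral>\<^sup>+z. indicator X (snd z) \<partial>\<pi>)"
      by (rule nn_integral_cong_AE, use AE_atom in eventually_elim)
        (simp add: sum_distrib_right[symmetric] w_sum del: One_nat_def)
    also have "\<dots> = (\<integral>\<^sup>+x. indicator X x \<partial>distr \<pi> \<beta> snd)"
      by (rule nn_integral_distr[symmetric]) measurable
    also have "\<dots> = emeasure \<beta> X"
      using \<beta> X by (simp add: snd_\<pi>)
    finally show "emeasure (distr \<pi>' \<beta> snd) X = emeasure \<beta> X" .
  qed simp
  have coup: "\<pi>' \<in> couplings (empirical N \<xi>') \<beta>"
    using fst_\<pi>' snd_\<pi>' sets_\<pi>' \<beta> by (simp add: couplings_def cong: sets_pair_measure_cong)
  note cost' = integrable_geodesic_dist[OF prob_space_empirical[OF N \<xi>'] sets_empirical \<beta> coup]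
  have space_\<pi>': "space \<pi>' = S2 \<times> S2"
    using sets_eq_imp_space_eq[OF sets_\<pi>'] by (simp add: space_pair_measure)
  have "ennreal (\<integral>z. ?d z \<partial>\<pi>') = (\<integral>\<^sup>+z. ennreal (?d z) \<partial>\<pi>')"
    using cost'(2) by (intro nn_integral_eq_integral[symmetric] AE_I2)
      (auto simp: space_\<pi>' geodesic_dist_bounds)
  also have "\<dots> = (\<integral>\<^sup>+z. (\<Sum>i\<in>?J. w i (fst z) * ennreal (geodesic_dist (\<xi>' i) (snd z))) \<partial>\<pi>)"
    using borel_measurable_integrable[OF cost'(2)] by (subst int_\<pi>') auto
  also have "\<dots> \<le> (\<integral>\<^sup>+z. ennreal (?d z + \<epsilon>) \<partial>\<pi>)"
  proof (rule nn_integral_mono_AE, use AE_atom AE_space in eventually_elim)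
    case (elim z)
    then have z: "snd z \<in> S2" "fst z \<in> S2"
      by (auto simp: space_\<pi>)
    have "(\<Sum>i\<in>?J. w i (fst z) * ennreal (geodesic_dist (\<xi>' i) (snd z)))
        \<le> (\<Sum>i\<in>?J. w i (fst z) * ennreal (?d z + \<epsilon>))"
    proof (rule sum_mono)
      fix i assume i: "i \<in> ?J"
      show "w i (fst z) * ennreal (geodesic_dist (\<xi>' i) (snd z)) \<le> w i (fst z) * ennreal (?d z + \<epsilon>)"
      proof (cases "fst z = \<xi> i")
        case True
        then show ?thesis
          using close[OF i z(1)] by (intro mult_left_mono ennreal_leI) auto
      qed (simp add: w_def)
    qed
    also have "\<dots> = ennreal (?d z + \<epsilon>)"
      using elim by (simp add: sum_distrib_right[symmetric] w_sum del: One_nat_def)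
    finally show ?case .
  qed
  also have "\<dots> = ennreal (\<integral>z. ?d z + \<epsilon> \<partial>\<pi>)"
    using cost(2) \<epsilon> by (intro nn_integral_eq_integral AE_I2)
      (auto simp: space_\<pi> geodesic_dist_bounds)
  also have "(\<integral>z. ?d z + \<epsilon> \<partial>\<pi>) = (\<integral>z. ?d z \<partial>\<pi>) + \<epsilon>"
    using cost(2) by (simp add: prob_space)
  finally have "(\<integral>z. ?d z \<partial>\<pi>') \<le> (\<integral>z. ?d z \<partial>\<pi>) + \<epsilon>"
    by (subst (asm) ennreal_le_iff) (use cost(3) \<epsilon> in auto)
  with coup show ?thesis ..
qed

lemma W1_empirical_move_atoms:
  assumes N: "N \<ge> 1" and \<xi>: "\<xi> \<in> {1..N} \<rightarrow> S2" and \<xi>': "\<xi>' \<in> {1..N} \<rightarrow> S2"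
    and "prob_space \<beta>" and \<beta>: "sets \<beta> = sets borel_S2" and \<epsilon>: "0 \<le> \<epsilon>"
    and close: "\<And>j y. j \<in> {1..N} \<Longrightarrow> y \<in> S2 \<Longrightarrow> geodesic_dist (\<xi>' j) y \<le> geodesic_dist (\<xi> j) y + \<epsilon>"
  shows "W1 (empirical N \<xi>') \<beta> \<le> W1 (empirical N \<xi>) \<beta> + \<epsilon>"
proof -
  have "W1 (empirical N \<xi>') \<beta> - \<epsilon> \<le> W1 (empirical N \<xi>) \<beta>"
    unfolding W1_def[of "empirical N \<xi>"]
  proof (rule cINF_greatest)
    show "couplings (empirical N \<xi>) \<beta> \<noteq> {}"
      using pair_measure_in_couplings[OF prob_space_empirical[OF N \<xi>] assms(4)] by auto
    fix \<pi> assume \<pi>: "\<pi> \<in> couplings (empirical N \<xi>) \<beta>"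
    have "\<exists>\<pi>' \<in> couplings (empirical N \<xi>') \<beta>.
        (\<integral>z. geodesic_dist (fst z) (snd z) \<partial>\<pi>')
          \<le> (\<integral>z. geodesic_dist (fst z) (snd z) \<partial>\<pi>) + \<epsilon>"
      by (rule move_atoms_coupling[OF N \<xi> \<xi>' \<beta> \<pi> \<epsilon>]) (rule close)
    then obtain \<pi>' where "\<pi>' \<in> couplings (empirical N \<xi>') \<beta>"
      and le: "(\<integral>z. geodesic_dist (fst z) (snd z) \<partial>\<pi>')
        \<le> (\<integral>z. geodesic_dist (fst z) (snd z) \<partial>\<pi>) + \<epsilon>" ..
    then have "W1 (empirical N \<xi>') \<beta> \<le> (\<integral>z. geodesic_dist (fst z) (snd z) \<partial>\<pi>')"
      by (intro W1_le_coupling prob_space_empirical[OF N \<xi>'] \<beta>) auto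
    with le show "W1 (empirical N \<xi>') \<beta> - \<epsilon> \<le> (\<integral>z. geodesic_dist (fst z) (snd z) \<partial>\<pi>)"
      by simp
  qed
  then show ?thesis
    by simp
qed

text \<open>
  Uniform continuity of \<open>arccos\<close> on \<open>[-1, 1]\<close> takes the place of the triangle inequality for the
  geodesic distance.
\<close>

lemma geodesic_dist_equicontinuous:
  assumes "0 < \<epsilon>"
  obtains \<delta> where "0 < \<delta>"
    and "\<And>x x' y. x \<in> S2 \<Longrightarrow> x' \<in> S2 \<Longrightarrow> y \<in> S2 \<Longrightarrow> dist x x' < \<delta> \<Longrightarrow>
      \<bar>geodesic_dist x y - geodesic_dist x' y\<bar> < \<epsilon>"
proof -
  have "uniformly_continuous_on {-1..1::real} arccos"
    by (intro compact_uniformly_continuous continuous_on_arccos') auto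
  then obtain \<delta> where \<delta>: "0 < \<delta>"
    and uc: "\<And>s t. s \<in> {-1..1} \<Longrightarrow> t \<in> {-1..1} \<Longrightarrow> dist t s < \<delta> \<Longrightarrow> dist (arccos t) (arccos s) < \<epsilon>"
    using assms unfolding uniformly_continuous_on_def by metis
  show thesis
  proof (rule that[OF \<delta>])
    fix x x' y :: "real^3"
    assume S: "x \<in> S2" "x' \<in> S2" "y \<in> S2" and d: "dist x x' < \<delta>"
    have "\<bar>(x - x') \<bullet> y\<bar> \<le> norm (x - x') * norm y"
      by (rule Cauchy_Schwarz_ineq2)
    then have "dist (x \<bullet> y) (x' \<bullet> y) < \<delta>"
      using d S by (simp add: dist_norm inner_diff_left S2_def)
    then show "\<bar>geodesic_dist x y - geodesic_dist x' y\<bar> < \<epsilon>"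
      using uc[of "x' \<bullet> y" "x \<bullet> y"] inner_S2_bounds S by (simp add: geodesic_dist_def dist_real_def)
  qed
qed

text \<open>
  The sample is a point of \<open>nat \<Rightarrow> real^3\<close> with the product topology; only the coordinates
  \<open>1, \<dots>, N\<close> matter. Continuity is what yields measurability, since the defining infimum
  ranges over uncountably many couplings.
\<close>

lemma continuous_on_W1_empirical:
  assumes N: "N \<ge> 1" and "prob_space \<beta>" and \<beta>: "sets \<beta> = sets borel_S2"
  shows "continuous_on {\<xi>. \<forall>j. \<xi> j \<in> S2} (\<lambda>\<xi>. W1 (empirical N \<xi>) \<beta>)"
  unfolding continuous_on_sequentially
proof (intro allI ballI impI)
  fix X :: "nat \<Rightarrow> nat \<Rightarrow> real^3" and \<xi>
  assume \<xi>: "\<xi> \<in> {\<xi>. \<forall>j. \<xi> j \<in> S2}"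
    and X: "(\<forall>n. X n \<in> {\<xi>. \<forall>j. \<xi> j \<in> S2}) \<and> X \<longlonglongrightarrow> \<xi>"
  have comp: "(\<lambda>n. X n j) \<longlonglongrightarrow> \<xi> j" for j
    using continuous_on_tendsto_compose[OF continuous_on_product_coordinates, of X \<xi> sequentially j] X
    by simp
  show "((\<lambda>\<xi>. W1 (empirical N \<xi>) \<beta>) \<circ> X) \<longlonglongrightarrow> W1 (empirical N \<xi>) \<beta>"
  proof (rule tendstoI)
    fix e :: real assume "0 < e"
    then obtain \<delta> where \<delta>: "0 < \<delta>"
      and eq: "\<And>x x' y. x \<in> S2 \<Longrightarrow> x' \<in> S2 \<Longrightarrow> y \<in> S2 \<Longrightarrow> dist x x' < \<delta> \<Longrightarrow>
        \<bar>geodesic_dist x y - geodesic_dist x' y\<bar> < e / 2"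
      using geodesic_dist_equicontinuous[of "e / 2"] by auto
    have "\<forall>\<^sub>F n in sequentially. \<forall>j\<in>{1..N}. dist (X n j) (\<xi> j) < \<delta>"
      using tendstoD[OF comp \<delta>] by (intro eventually_ball_finite) auto
    then show "\<forall>\<^sub>F n in sequentially.
        dist (((\<lambda>\<xi>. W1 (empirical N \<xi>) \<beta>) \<circ> X) n) (W1 (empirical N \<xi>) \<beta>) < e"
    proof eventually_elim
      case (elim n)
      have S: "X n \<in> {1..N} \<rightarrow> S2" "\<xi> \<in> {1..N} \<rightarrow> S2"
        using X \<xi> by auto
      have close: "geodesic_dist (X n j) y \<le> geodesic_dist (\<xi> j) y + e / 2"
          "geodesic_dist (\<xi> j) y \<le> geodesic_dist (X n j) y + e / 2"
        if "j \<in> {1..N}" "y \<in> S2" for j y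
      proof -
        have "\<bar>geodesic_dist (X n j) y - geodesic_dist (\<xi> j) y\<bar> < e / 2"
          using that S elim by (intro eq) auto
        then show "geodesic_dist (X n j) y \<le> geodesic_dist (\<xi> j) y + e / 2"
            "geodesic_dist (\<xi> j) y \<le> geodesic_dist (X n j) y + e / 2"
          by linarith+
      qed
      have "W1 (empirical N (X n)) \<beta> \<le> W1 (empirical N \<xi>) \<beta> + e / 2"
        by (rule W1_empirical_move_atoms[OF N S(2,1) assms(2) \<beta> _ close(1)])
          (use \<open>0 < e\<close> in auto)
      moreover have "W1 (empirical N \<xi>) \<beta> \<le> W1 (empirical N (X n)) \<beta> + e / 2"
        by (rule W1_empirical_move_atoms[OF N S assms(2) \<beta> _ close(2)])
          (use \<open>0 < e\<close> in auto)
      ultimately show ?case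
        using \<open>0 < e\<close> by (simp add: dist_real_def)
    qed
  qed
qed

lemma borel_measurable_W1_empirical:
  assumes N: "N \<ge> 1" and "prob_space \<mu>" and \<mu>: "sets \<mu> = sets borel_S2"
  shows "(\<lambda>\<xi>. W1 (empirical N \<xi>) \<mu>) \<in> borel_measurable (Pi\<^sub>M {1..N} (\<lambda>_. \<mu>))"
proof -
  let ?S = "{\<xi> :: nat \<Rightarrow> real^3. \<forall>j. \<xi> j \<in> S2}" and ?P = "Pi\<^sub>M {1..N} (\<lambda>_. \<mu>)"
  have space: "space \<mu> = S2"
    using sets_eq_imp_space_eq[OF \<mu>] by simp
  obtain p where p: "p \<in> S2"
    by (metis S2_def norm_axis_1 mem_sphere_0)
  \<comment> \<open>Samples in \<open>Pi\<^sub>M {1..N}\<close> are undefined outside \<open>{1..N}\<close>; filling in a point of the sphere embeds them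
    into the full product, whose product and Borel \<open>\<sigma>\<close>-algebras agree.\<close>
  define ext where "ext \<xi> j = (if j \<in> {1..N} then \<xi> j else p)" for \<xi> :: "nat \<Rightarrow> real^3" and j
  have W1_ext: "W1 (empirical N (ext \<xi>)) \<mu> = W1 (empirical N \<xi>) \<mu>" for \<xi>
  proof -
    have "empirical N (ext \<xi>) = empirical N \<xi>"
      unfolding empirical_def by (intro distr_cong) (auto simp: ext_def space_uniform_count_measure)
    then show ?thesis by simp
  qed
  have "ext \<in> ?P \<rightarrow>\<^sub>M Pi\<^sub>M UNIV (\<lambda>_. borel)"
  proof (rule measurable_PiM_single')
    fix j
    have "(\<lambda>\<xi>. \<xi> j) \<in> ?P \<rightarrow>\<^sub>M borel" if "j \<in> {1..N}"
    proof (rule measurable_compose[OF measurable_component_singleton[OF that]])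
      show "(\<lambda>x. x) \<in> \<mu> \<rightarrow>\<^sub>M borel"
        unfolding measurable_cong_sets[OF \<mu> refl] borel_S2_def
        by (rule measurable_restrict_space1) simp
    qed
    then show "(\<lambda>\<xi>. ext \<xi> j) \<in> ?P \<rightarrow>\<^sub>M borel"
      unfolding ext_def by (cases "j \<in> {1..N}") auto
  qed auto
  then have "ext \<in> ?P \<rightarrow>\<^sub>M borel"
    by (simp add: measurable_cong_sets[OF refl sets_PiM_equal_borel])
  moreover have "ext \<in> space ?P \<rightarrow> ?S"
    using p by (auto simp: ext_def space_PiM space)
  ultimately have "ext \<in> ?P \<rightarrow>\<^sub>M restrict_space borel ?S"
    by (intro measurable_restrict_space2) auto
  moreover have "(\<lambda>\<xi>. W1 (empirical N \<xi>) \<mu>) \<in> borel_measurable (restrict_space borel ?S)"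
    by (intro borel_measurable_continuous_on_restrict continuous_on_W1_empirical assms)
  ultimately have "(\<lambda>\<xi>. W1 (empirical N (ext \<xi>)) \<mu>) \<in> borel_measurable ?P"
    by (rule measurable_compose)
  then show ?thesis
    by (simp only: W1_ext)
qed

section \<open>The expected Wasserstein distance\<close>

text \<open>
  One-scale bound: couple so that the points share a cell, of diameter at most \<open>\<delta>\<close>, as often as
  possible, and pay at most \<open>pi\<close> otherwise.
\<close>

lemma W1_le_cells:
  fixes c :: "real^3 \<Rightarrow> 'i"
  assumes \<alpha>: "prob_space \<alpha>" "sets \<alpha> = sets borel_S2" and \<beta>: "prob_space \<beta>" "sets \<beta> = sets borel_S2"
    and fin: "finite I" and c: "c \<in> borel_S2 \<rightarrow>\<^sub>M count_space I"
    and diam: "\<And>x y. x \<in> S2 \<Longrightarrow> y \<in> S2 \<Longrightarrow> c x = c y \<Longrightarrow> geodesic_dist x y \<le> \<delta>"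
    and "0 \<le> \<delta>"
  shows "W1 \<alpha> \<beta> \<le> \<delta> + pi * (\<Sum>i\<in>I. \<bar>measure \<alpha> (c -` {i} \<inter> S2) - measure \<beta> (c -` {i} \<inter> S2)\<bar>)"
proof -
  have sp: "space \<alpha> = S2" "space \<beta> = S2"
    using sets_eq_imp_space_eq[OF \<alpha>(2)] sets_eq_imp_space_eq[OF \<beta>(2)] by auto
  have c_\<alpha>: "c \<in> \<alpha> \<rightarrow>\<^sub>M count_space I" and c_\<beta>: "c \<in> \<beta> \<rightarrow>\<^sub>M count_space I"
    using c by (simp_all add: measurable_cong_sets[OF \<alpha>(2) refl] measurable_cong_sets[OF \<beta>(2) refl])
  obtain \<pi> where \<pi>: "\<pi> \<in> couplings \<alpha> \<beta>"
    and le: "measure \<pi> {z \<in> space \<pi>. c (fst z) \<noteq> c (snd z)}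
      \<le> (\<Sum>i\<in>I. \<bar>measure \<alpha> (c -` {i} \<inter> S2) - measure \<beta> (c -` {i} \<inter> S2)\<bar>)"
    using coupling_of_labels[OF \<alpha>(1) \<beta>(1) fin c_\<alpha> c_\<beta>] unfolding sp by blast
  let ?D = "{z \<in> space \<pi>. c (fst z) \<noteq> c (snd z)}"
  note cost = integrable_geodesic_dist[OF \<alpha> \<beta>(2) \<pi>]
  interpret prob_space \<pi> by (rule cost(1))
  have sets_\<pi>: "sets \<pi> = sets (borel_S2 \<Otimes>\<^sub>M borel_S2)"
    using \<pi> \<alpha> \<beta> by (simp add: couplings_def cong: sets_pair_measure_cong)
  have space_\<pi>: "space \<pi> = S2 \<times> S2"
    using sets_eq_imp_space_eq[OF sets_\<pi>] by (simp add: space_pair_measure)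
  note [measurable_cong] = sets_\<pi>
  note c[measurable]
  have "(\<lambda>z. (c (fst z), c (snd z))) \<in> \<pi> \<rightarrow>\<^sub>M count_space I \<Otimes>\<^sub>M count_space I"
    by measurable
  then have "(\<lambda>z. (c (fst z), c (snd z))) \<in> \<pi> \<rightarrow>\<^sub>M count_space (I \<times> I)"
    using fin by (simp add: pair_measure_countable countable_finite)
  from measurable_sets_Collect[OF this, of "\<lambda>(i, j). i \<noteq> j"] have D: "?D \<in> sets \<pi>"
    by simp
  have intD: "integrable \<pi> (indicator ?D :: _ \<Rightarrow> real)"
    using D by (intro integrable_const_bound[where B = 1]) auto
  have "(\<integral>z. geodesic_dist (fst z) (snd z) \<partial>\<pi>) \<le> (\<integral>z. \<delta> + pi * indicator ?D z \<partial>\<pi>)"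
  proof (rule integral_mono)
    fix z assume z: "z \<in> space \<pi>"
    then have S: "fst z \<in> S2" "snd z \<in> S2"
      by (auto simp: space_\<pi>)
    show "geodesic_dist (fst z) (snd z) \<le> \<delta> + pi * indicator ?D z"
      using diam[OF S] geodesic_dist_bounds(2)[OF S] z \<open>0 \<le> \<delta>\<close> by (auto simp: indicator_def)
  qed (use cost(2) intD in auto)
  also have "\<dots> = \<delta> + pi * measure \<pi> ?D"
    using intD D by (simp add: prob_space)
  also have "\<dots> \<le> \<delta> + pi * (\<Sum>i\<in>I. \<bar>measure \<alpha> (c -` {i} \<inter> S2) - measure \<beta> (c -` {i} \<inter> S2)\<bar>)"
    using le by (intro add_left_mono mult_left_mono) auto
  finally show ?thesis
    using W1_le_coupling[OF \<alpha> \<beta>(2) \<pi>] by linarith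
qed

text \<open>
  With a free weight \<open>l\<close> this replaces both the Jensen inequality for each cell and the
  Cauchy-Schwarz inequality over the cells.
\<close>

lemma abs_le_weighted_square:
  fixes t l :: real
  assumes "0 < l"
  shows "\<bar>t\<bar> \<le> l / 2 * t\<^sup>2 + 1 / (2 * l)"
proof -
  have "0 \<le> (l * \<bar>t\<bar> - 1)\<^sup>2 / (2 * l)"
    using assms by simp
  also have "\<dots> = l / 2 * t\<^sup>2 + 1 / (2 * l) - \<bar>t\<bar>"
    using assms by (simp add: power2_diff power_mult_distrib field_simps power2_eq_square)
  finally show ?thesis by simp
qed

lemma integrable_W1_empirical:
  assumes N: "N \<ge> 1" and "prob_space \<mu>" and \<mu>: "sets \<mu> = sets borel_S2"
  shows "integrable (Pi\<^sub>M {1..N} (\<lambda>_. \<mu>)) (\<lambda>\<xi>. W1 (empirical N \<xi>) \<mu>)"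
proof -
  interpret \<mu>: prob_space \<mu> by fact
  interpret product_prob_space "\<lambda>_. \<mu>" "{1..N}" ..
  have "W1 (empirical N \<xi>) \<mu> \<in> {0..pi}" if "\<xi> \<in> space (Pi\<^sub>M {1..N} (\<lambda>_. \<mu>))" for \<xi>
  proof -
    have "\<xi> \<in> {1..N} \<rightarrow> S2"
      using that sets_eq_imp_space_eq[OF \<mu>] by (auto simp: space_PiM)
    then show ?thesis
      by (intro W1_bounds prob_space_empirical assms) auto
  qed
  then show ?thesis
    by (intro integrable_const_bound[where B = pi] AE_I2 borel_measurable_W1_empirical assms) auto
qed

text \<open>
  The one-scale bound for the cells of mesh \<open>\<eta>\<close>, in expectation. The cell variances add up to at most
  \<open>1 / N\<close>, there are at most \<open>50 / \<eta>\<^sup>2\<close> cells, and \<open>l\<close> is the weight of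
  \<open>abs_le_weighted_square\<close>.
\<close>

lemma expected_W1_empirical_le:
  assumes N: "N \<ge> 1" and "prob_space \<mu>" and \<mu>: "sets \<mu> = sets borel_S2"
    and \<eta>: "0 < \<eta>" "\<eta> \<le> 1" and l: "0 < l"
  shows "(\<integral>\<xi>. W1 (empirical N \<xi>) \<mu> \<partial>Pi\<^sub>M {1..N} (\<lambda>_. \<mu>))
    \<le> 10 * \<eta> + pi * (l / 2 / real N + 25 / (\<eta>\<^sup>2 * l))"
proof -
  interpret \<mu>: prob_space \<mu> by fact
  interpret product_prob_space "\<lambda>_. \<mu>" "{1..N}" ..
  let ?P = "Pi\<^sub>M {1..N} (\<lambda>_. \<mu>)" and ?I = "spherical_cells \<eta>"
  define C where "C i = spherical_cell \<eta> -` {i} \<inter> S2" for i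
  define q where "q i \<xi> = (measure (empirical N \<xi>) (C i) - measure \<mu> (C i))\<^sup>2" for i \<xi>
  note cell = measurable_spherical_cell[OF \<eta>(1)]
  have C: "C i \<in> sets borel_S2" if "i \<in> ?I" for i
    using measurable_sets[OF cell, of "{i}"] that by (simp add: C_def)
  have space: "space \<mu> = S2"
    using sets_eq_imp_space_eq[OF \<mu>] by simp
  have q: "integrable ?P (q i)" "(\<integral>\<xi>. q i \<xi> \<partial>?P) \<le> measure \<mu> (C i) / real N" if "i \<in> ?I" for i
    unfolding q_def using empirical_variance_le[OF assms(2) \<mu> C[OF that] N] by auto
  have total: "(\<Sum>i\<in>?I. measure \<mu> (C i)) = 1"
    using sum_measure_labels[OF assms(2), of "spherical_cell \<eta>" ?I] cell
    by (simp add: C_def space measurable_cong_sets[OF \<mu> refl])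
  have "(\<integral>\<xi>. W1 (empirical N \<xi>) \<mu> \<partial>?P)
      \<le> (\<integral>\<xi>. 10 * \<eta> + pi * (\<Sum>i\<in>?I. l / 2 * q i \<xi> + 1 / (2 * l)) \<partial>?P)"
  proof (rule integral_mono)
    show "integrable ?P (\<lambda>\<xi>. W1 (empirical N \<xi>) \<mu>)"
      by (intro integrable_W1_empirical assms)
    show "integrable ?P (\<lambda>\<xi>. 10 * \<eta> + pi * (\<Sum>i\<in>?I. l / 2 * q i \<xi> + 1 / (2 * l)))"
      using q by (intro Bochner_Integration.integrable_add integrable_const integrable_mult_right
          Bochner_Integration.integrable_sum)
    fix \<xi> assume "\<xi> \<in> space ?P"
    then have "\<xi> \<in> {1..N} \<rightarrow> S2"
      by (auto simp: space_PiM space)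
    then have "W1 (empirical N \<xi>) \<mu>
        \<le> 10 * \<eta> + pi * (\<Sum>i\<in>?I. \<bar>measure (empirical N \<xi>) (C i) - measure \<mu> (C i)\<bar>)"
      unfolding C_def using \<eta>
      by (intro W1_le_cells prob_space_empirical N assms(2) \<mu> cell geodesic_dist_spherical_cell) auto
    also have "\<dots> \<le> 10 * \<eta> + pi * (\<Sum>i\<in>?I. l / 2 * q i \<xi> + 1 / (2 * l))"
      unfolding q_def by (intro add_left_mono mult_left_mono sum_mono abs_le_weighted_square l) auto
    finally show "W1 (empirical N \<xi>) \<mu> \<le> 10 * \<eta> + pi * (\<Sum>i\<in>?I. l / 2 * q i \<xi> + 1 / (2 * l))" .
  qed
  also have "\<dots> = 10 * \<eta> + pi * (\<Sum>i\<in>?I. l / 2 * (\<integral>\<xi>. q i \<xi> \<partial>?P) + 1 / (2 * l))"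
    using q(1) prob_space.prob_space[OF prob_space_PiM[OF assms(2)], of "{1..N}"]
    by (simp add: Bochner_Integration.integral_add Bochner_Integration.integral_sum del: One_nat_def)
  also have "\<dots> \<le> 10 * \<eta> + pi * (\<Sum>i\<in>?I. l / 2 * (measure \<mu> (C i) / real N) + 1 / (2 * l))"
    using q(2) l by (intro add_left_mono mult_left_mono sum_mono add_right_mono) auto
  also have "(\<Sum>i\<in>?I. l / 2 * (measure \<mu> (C i) / real N) + 1 / (2 * l))
      = l / 2 / real N * (\<Sum>i\<in>?I. measure \<mu> (C i)) + real (card ?I) * (1 / (2 * l))"
    by (simp add: sum.distrib sum_distrib_left)
  also have "\<dots> \<le> l / 2 / real N + 50 / \<eta>\<^sup>2 * (1 / (2 * l))"
    unfolding total using card_spherical_cells[OF \<eta>] l by (intro add_mono mult_right_mono) auto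
  also have "50 / \<eta>\<^sup>2 * (1 / (2 * l)) = 25 / (\<eta>\<^sup>2 * l)"
    by simp
  finally show ?thesis
    by simp
qed

lemma expected_W1_empirical_rate:
  assumes "prob_space \<mu>" and \<mu>: "sets \<mu> = sets borel_S2" and N: "N \<ge> 1"
  shows "(\<integral>\<xi>. W1 (empirical N \<xi>) \<mu> \<partial>Pi\<^sub>M {1..N} (\<lambda>_. \<mu>)) \<le> (10 + 26 * pi) * real N powr (-1/4)"
proof -
  \<comment> \<open>The mesh balances the cell diameter against the fluctuation \<open>1 / (\<eta> * sqrt N)\<close>; the weight \<open>N * \<eta>\<close>
    makes the two terms of the fluctuation comparable.\<close>
  let ?\<eta> = "real N powr (-1/4)" and ?l = "real N powr (3/4)"
  have pos: "0 < real N"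
    using N by simp
  have \<eta>: "0 < ?\<eta>" "?\<eta> \<le> 1"
    using N powr_mono[of "-1/4" 0 "real N"] by auto
  have "?l / 2 / real N = ?\<eta> / 2"
    using pos powr_diff[of "real N" "3/4" 1] by simp
  moreover have "?\<eta>\<^sup>2 * ?l = real N powr (1/4)"
    using pos by (simp add: power2_eq_square powr_add[symmetric])
  then have "25 / (?\<eta>\<^sup>2 * ?l) = 25 * ?\<eta>"
    using powr_minus_divide[of "real N" "1/4"] by simp
  ultimately have "10 * ?\<eta> + pi * (?l / 2 / real N + 25 / (?\<eta>\<^sup>2 * ?l)) = (10 + pi * (51 / 2)) * ?\<eta>"
    by (simp only:) (simp add: algebra_simps)
  also have "\<dots> \<le> (10 + 26 * pi) * ?\<eta>"
    by (intro mult_right_mono) auto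
  finally show ?thesis
    using expected_W1_empirical_le[OF N assms(1) \<mu> \<eta>, of ?l] pos by simp
qed

theorem proposition4p5:
  fixes \<mu> :: "(real^3) measure" and f :: "real^3 \<Rightarrow> real" and M :: real
  assumes "prob_space \<mu>"
    and "f \<in> borel_measurable nu1"
    and "AE x in nu1. 0 \<le> f x"
    and "\<mu> = density nu1 (\<lambda>x. ennreal (f x))"
    and "esssup nu1 (\<lambda>x. ereal \<bar>f x\<bar>) \<le> ereal M"
  shows "(\<forall>N\<ge>1. integrable (Pi\<^sub>M {1..N} (\<lambda>_. \<mu>)) (\<lambda>\<xi>. W1 (empirical N \<xi>) \<mu>)) \<and>
    (\<lambda>N. \<integral>\<xi>. W1 (empirical N \<xi>) \<mu> \<partial>Pi\<^sub>M {1..N} (\<lambda>_. \<mu>)) \<in> O(\<lambda>N. real N powr (-1/4))"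
proof (intro conjI allI impI)
  have \<mu>: "sets \<mu> = sets borel_S2"
    using assms(4) by simp
  show int: "integrable (Pi\<^sub>M {1..N} (\<lambda>_. \<mu>)) (\<lambda>\<xi>. W1 (empirical N \<xi>) \<mu>)" if "N \<ge> 1" for N
    using that by (intro integrable_W1_empirical assms(1) \<mu>)
  show "(\<lambda>N. \<integral>\<xi>. W1 (empirical N \<xi>) \<mu> \<partial>Pi\<^sub>M {1..N} (\<lambda>_. \<mu>)) \<in> O(\<lambda>N. real N powr (-1/4))"
  proof (rule bigoI[where c = "10 + 26 * pi"], rule eventually_sequentiallyI[of 1])
    fix N :: nat assume N: "1 \<le> N"
    have "0 \<le> (\<integral>\<xi>. W1 (empirical N \<xi>) \<mu> \<partial>Pi\<^sub>M {1..N} (\<lambda>_. \<mu>))"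
    proof (intro Bochner_Integration.integral_nonneg_AE AE_I2)
      fix \<xi> assume "\<xi> \<in> space (Pi\<^sub>M {1..N} (\<lambda>_. \<mu>))"
      then have "\<xi> \<in> {1..N} \<rightarrow> S2"
        using sets_eq_imp_space_eq[OF \<mu>] by (auto simp: space_PiM)
      then show "0 \<le> W1 (empirical N \<xi>) \<mu>"
        using W1_bounds[OF prob_space_empirical[OF N] assms(1) sets_empirical \<mu>] by simp
    qed
    then show "norm (\<integral>\<xi>. W1 (empirical N \<xi>) \<mu> \<partial>Pi\<^sub>M {1..N} (\<lambda>_. \<mu>))
        \<le> (10 + 26 * pi) * norm (real N powr (-1/4))"
      using expected_W1_empirical_rate[OF assms(1) \<mu> N] by simp
  qed
qed

end
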